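(* For every $\gamma \in (0,\infty)$ with $\gamma\neq 1$ and every $b\in\mathbb{R}$, let $$\alpha(\gamma,b) := \begin{cases} \left(\frac{1-b}{2-\gamma}\wedge 1\right)\vee 0 & \text{if } \gamma<1,\\[4pt] \left(\frac{\gamma-b}{\gamma}\wedge 1\right)\vee 0 & \text{if } \gamma>1.\end{cases}$$ Then for every $\gamma\in(0,\infty)\setminus\{1\}$, $b\in\mathbb{R}$, $p\in[1,\infty]$ and $\varepsilon>0$, $$\lim_{N\to\infty} \mathbb{P}^{b,p}_{\gamma}\left[\left|\frac{\log \mathcal{H}_p(\mathcal{G}_N)}{\log N}-\alpha(\gamma,b)\right|>\varepsilon\right]=0.$$
   Context: For a positive integer $N$, let $V_N=\{0,\ldots,N-1\}$, $E^\circ_N=\{\{x,x+1\}: x,x+1\in V_N\}$, $\mathscr{E}_N=\{\{x,y\}: x\neq y\in V_N\}$, and let $\mathscr{G}_N$ be the set of graphs $g=(V_N,E_N)$ with $E^\circ_N\subseteq E_N\subseteq\mathscr{E}_N$. For $e=\{x,y\}\in\mathscr{E}_N$, write $|e|=|y-x|$. For $g\in\mathscr{G}_N$, $\mathsf{d}_g(x,y)$ is the graph distance in $g$ (least number of edges of a path from $x$ to $y$). For $p\in[1,\infty)$, $$\mathcal{H}_p(g)=\Big(\frac1{N^2}\sum_{x,y\in V_N}\mathsf{d}_g^p(x,y)\Big)^{1/p},$$ and $\mathcal{H}_\infty(g)=\max_{x,y\in V_N}\mathsf{d}_g(x,y)$. $\mathcal{G}_N=(V_N,\mathcal{E}_N)$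 denotes the canonical random graph on $\mathscr{G}_N$. For $\gamma\in(0,\infty)$, $\mathbb{P}_\gamma$ is the probability measure on $\mathscr{G}_N$ under which the events $\{e\in\mathcal{E}_N\}$, for $e\in\mathscr{E}_N$ with $|e|>1$, are independent, each with probability $\exp(-|e|^\gamma)$ (edges in $E^\circ_N$ are always present). $\mathbb{E}_\gamma$ is the associated expectation. For $b\in\mathbb{R}$ and $p\in[1,\infty]$, $\mathbb{P}^{b,p}_\gamma$ is the probability measure on $\mathscr{G}_N$ given, for every $g\in\mathscr{G}_N$, by $$\mathbb{P}^{b,p}_\gamma[\mathcal{G}_N=g]=\frac{1}{Z^{b,p}_{\gamma,N}}\exp\big(-N^b\,\mathcal{H}_p(g)\big)\,\mathbb{P}_\gamma[\mathcal{G}_N=g],\qquad Z^{b,p}_{\gamma,N}=\mathbb{E}_\gamma\big[\exp(-N^b\mathcal{H}_p(\mathcal{G}_N))\big].$$ The dependence of these measures on $N$ is not displayed. $\wedge$ and $\vee$ denote minimum and maximum. *)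

theory Defs
  imports "HOL-Probability.Probability"
begin

text \<open>
  All graphs on \<open>N\<close> vertices considered here share the vertex set \<open>verts N\<close>, so a graph is
  identified with its edge set. An edge is a two-element set of vertices.
\<close>

type_synonym graph = "nat set set"

definition verts :: "nat \<Rightarrow> nat set" where
  "verts N = {0..<N}"

definition line_edges :: "nat \<Rightarrow> nat set set" where
  "line_edges N = {{x, x + 1} | x. x \<in> verts N \<and> x + 1 \<in> verts N}"

definition all_edges :: "nat \<Rightarrow> nat set set" where
  "all_edges N = {{x, y} | x y. x \<in> verts N \<and> y \<in> verts N \<and> x \<noteq> y}"

definition graphs :: "nat \<Rightarrow> graph set" where
  "graphs N = {E. line_edges N \<subseteq> E \<and> E \<subseteq> all_edges N}"

definition edge_length :: "nat set \<Rightarrow> nat" where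
  "edge_length e = Max e - Min e"

lemma edge_length_doubleton: "real (edge_length {x, y}) = \<bar>real y - real x\<bar>"
  by (cases "x \<le> y") (auto simp: edge_length_def max_def min_def)

text \<open>A path is given by its list of vertices; it has one edge fewer than it has vertices.\<close>

definition path_between :: "graph \<Rightarrow> nat \<Rightarrow> nat \<Rightarrow> nat list \<Rightarrow> bool" where
  "path_between E x y vs \<longleftrightarrow>
     vs \<noteq> [] \<and> hd vs = x \<and> last vs = y \<and> distinct vs \<and> successively (\<lambda>u v. {u, v} \<in> E) vs"

definition graph_dist :: "graph \<Rightarrow> nat \<Rightarrow> nat \<Rightarrow> nat" where
  "graph_dist E x y = (LEAST k. \<exists>vs. path_between E x y vs \<and> length vs = k + 1)"

definition Hp :: "ereal \<Rightarrow> nat \<Rightarrow> graph \<Rightarrow> real" where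
  "Hp p N E =
     (if p = \<infinity> then Max {real (graph_dist E x y) | x y. x \<in> verts N \<and> y \<in> verts N}
      else (1 / real N ^ 2 *
             (\<Sum>x\<in>verts N. \<Sum>y\<in>verts N. real (graph_dist E x y) powr real_of_ereal p))
           powr (1 / real_of_ereal p))"

definition long_edges :: "nat \<Rightarrow> nat set set" where
  "long_edges N = {e \<in> all_edges N. edge_length e > 1}"

definition percolation :: "real \<Rightarrow> nat \<Rightarrow> graph pmf" where
  "percolation \<gamma> N =
     map_pmf (\<lambda>\<omega>. line_edges N \<union> {e \<in> long_edges N. \<omega> e})
       (Pi_pmf (long_edges N) False
          (\<lambda>e. bernoulli_pmf (exp (- (real (edge_length e) powr \<gamma>)))))"

definition partition_fun :: "real \<Rightarrow> real \<Rightarrow> ereal \<Rightarrow> nat \<Rightarrow> real" where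
  "partition_fun \<gamma> b p N =
     measure_pmf.expectation (percolation \<gamma> N) (\<lambda>E. exp (- (real N powr b) * Hp p N E))"

text \<open>
  \<open>embed_pmf\<close> is only meaningful for a nonnegative mass function of total mass one; this is
  checked in \<open>pmf_gibbs\<close> below.
\<close>

definition gibbs :: "real \<Rightarrow> real \<Rightarrow> ereal \<Rightarrow> nat \<Rightarrow> graph pmf" where
  "gibbs \<gamma> b p N =
     embed_pmf (\<lambda>E. 1 / partition_fun \<gamma> b p N * exp (- (real N powr b) * Hp p N E)
                      * pmf (percolation \<gamma> N) E)"

definition \<alpha> :: "real \<Rightarrow> real \<Rightarrow> real" where
  "\<alpha> \<gamma> b = (if \<gamma> < 1 then max (min ((1 - b) / (2 - \<gamma>)) 1) 0
            else max (min ((\<gamma> - b) / \<gamma>) 1) 0)"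

lemma line_edges_subset_all: "line_edges N \<subseteq> all_edges N"
  by (force simp: line_edges_def all_edges_def)

lemma finite_all_edges: "finite (all_edges N)"
  by (rule finite_subset[of _ "Pow (verts N)"]) (auto simp: all_edges_def verts_def)

lemma finite_graphs: "finite (graphs N)"
  by (rule finite_subset[of _ "Pow (all_edges N)"]) (auto simp: graphs_def finite_all_edges)

lemma set_percolation_subset: "set_pmf (percolation \<gamma> N) \<subseteq> graphs N"
  using line_edges_subset_all by (auto simp: percolation_def graphs_def long_edges_def)

lemma partition_fun_pos: "partition_fun \<gamma> b p N > 0"
proof -
  let ?P = "percolation \<gamma> N"
  have fin: "finite (set_pmf ?P)"
    using finite_subset[OF set_percolation_subset finite_graphs] .
  have "partition_fun \<gamma> b p N =
      (\<Sum>E\<in>set_pmf ?P. pmf ?P E * exp (- (real N powr b) * Hp p N E))"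
    unfolding partition_fun_def by (subst integral_measure_pmf[OF fin]) auto
  also have "\<dots> > 0"
    by (intro sum_pos fin set_pmf_not_empty mult_pos_pos) (auto simp: pmf_positive)
  finally show ?thesis .
qed

lemma pmf_gibbs:
  "pmf (gibbs \<gamma> b p N) E =
     1 / partition_fun \<gamma> b p N * exp (- (real N powr b) * Hp p N E) * pmf (percolation \<gamma> N) E"
  unfolding gibbs_def
proof (rule pmf_embed_pmf)
  let ?P = "percolation \<gamma> N"
  let ?Z = "partition_fun \<gamma> b p N"
  let ?w = "\<lambda>E. exp (- (real N powr b) * Hp p N E)"
  let ?f = "\<lambda>E. 1 / ?Z * ?w E * pmf ?P E"
  have fin: "finite (set_pmf ?P)"
    using finite_subset[OF set_percolation_subset finite_graphs] .
  have pos: "?Z > 0" by (rule partition_fun_pos)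
  show nn: "0 \<le> ?f E" for E using pos by simp
  have "(\<integral>\<^sup>+E. ennreal (?f E) \<partial>count_space UNIV) = (\<Sum>E\<in>set_pmf ?P. ennreal (?f E))"
    by (rule nn_integral_count_space'[OF fin]) (auto simp: set_pmf_iff)
  also have "\<dots> = ennreal (\<Sum>E\<in>set_pmf ?P. ?f E)"
    by (rule sum_ennreal) (use nn in auto)
  also have "(\<Sum>E\<in>set_pmf ?P. ?f E) = 1 / ?Z * (\<Sum>E\<in>set_pmf ?P. pmf ?P E * ?w E)"
    by (simp add: sum_distrib_left mult_ac)
  also have "(\<Sum>E\<in>set_pmf ?P. pmf ?P E * ?w E) = ?Z"
    unfolding partition_fun_def by (subst integral_measure_pmf[OF fin]) auto
  also have "1 / ?Z * ?Z = 1" using pos by simp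
  finally show "(\<integral>\<^sup>+E. ennreal (?f E) \<partial>count_space UNIV) = 1" by simp
qed

end

theory Submission
  imports Defs "HOL-Real_Asymp.Real_Asymp"
begin

text \<open>
  Under percolation, a prescribed set of long edges is present with probability
  \<open>exp (- \<Sum> \<bar>e\<bar>\<^sup>\<gamma>)\<close>. The Gibbs measure therefore compares two powers of \<open>N\<close>: the cost
  \<open>\<Sum> \<bar>e\<bar>\<^sup>\<gamma>\<close> of the long edges needed to bring \<open>Hp\<close> down to \<open>N powr a\<close>, and the energy
  \<open>N powr (b + a)\<close> that remains. The cheapest cost is \<open>N powr cost_exponent \<gamma> a\<close> to leading order,
  which decreases in \<open>a\<close>, whereas the energy increases; they balance at \<open>a = \<alpha> \<gamma> b\<close>
  (\<open>cost_exponent_\<alpha>_le\<close>, \<open>cost_exponent_\<alpha>_ge\<close>).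

  The cost is attained, up to logarithms, by a dyadic graph: at each scale \<open>2 ^ k\<close> of a suitable
  range, consecutive multiples of \<open>2 ^ k\<close> are joined. Its diameter bounds \<open>Hp\<close> for every \<open>p\<close>, and
  forcing its edges to be present bounds the partition function from below by
  \<open>exp (- N powr (b + \<alpha> \<gamma> b + \<delta>))\<close> (\<open>partition_fun_eventually_ge\<close>). The energy of a graph with larger
  \<open>Hp\<close> is too high in comparison, which gives \<open>gibbs_upper_tail\<close>.

  That no graph does better rests on a deterministic fact. If \<open>Hp \<le> h\<close>, then by Markov's
  inequality most pairs are within distance \<open>4 h\<close>, so at least half of the vertices escape from
  their window of radius \<open>W \<le> N / 6\<close> within \<open>4 h\<close> steps. If \<open>W = 8 h l\<close>, edges shorter than \<open>l\<close> account for at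
  most half of the displacement, and summing over the windows shows that the lengths of the
  longer edges, truncated at \<open>W\<close>, add up to at least \<open>N / 24\<close> (\<open>small_Hp_truncated_length\<close>). This
  turns into a lower bound on their cost; for \<open>\<gamma> < 1\<close> it is sharp with \<open>l\<close> a small power of \<open>N\<close>, and
  for \<open>\<gamma> > 1\<close> with \<open>l\<close> close to \<open>N / h\<close>. An exponential moment bound in which only edges longer than
  \<open>l\<close> are counted shows that so high a cost is as improbable as it should be (\<open>long_weight_tail\<close>,
  \<open>percolation_small_Hp\<close>), and \<open>gibbs_lower_tail\<close> follows. Where \<open>\<alpha>\<close> is clipped to 0 or 1, one of
  the two tails is trivial, because \<open>1 / 5 < Hp \<le> N\<close>.
\<close>

section \<open>Walks and graph distances\<close>

definition adj :: "graph \<Rightarrow> (nat \<times> nat) set" where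
  "adj E = {(u, v). {u, v} \<in> E}"

text \<open>
  A shortcut can be taken whenever the walk revisits a vertex. Walks are easier to build than
  paths, since they can be concatenated and reversed, so upper bounds on distances go
  through them.
\<close>

lemma path_of_walk:
  assumes "(x, y) \<in> adj E ^^ k"
  shows "\<exists>vs. path_between E x y vs \<and> length vs \<le> k + 1"
  using assms
proof (induction k arbitrary: y)
  case 0
  then show ?case
    by (intro exI[of _ "[x]"]) (auto simp: path_between_def)
next
  case (Suc k)
  then obtain z where z: "(x, z) \<in> adj E ^^ k" "{z, y} \<in> E"
    by (auto simp: adj_def)
  obtain vs where vs: "path_between E x z vs" "length vs \<le> k + 1"
    using Suc.IH[OF z(1)] by auto
  show ?case
  proof (cases "y \<in> set vs")
    case True
    then obtain as bs where "vs = as @ y # bs"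
      by (meson split_list)
    then have eq: "vs = (as @ [y]) @ bs" by simp
    with vs(1) have "successively (\<lambda>u v. {u, v} \<in> E) (as @ [y])"
      by (simp only: path_between_def successively_append_iff)
    moreover have "hd (as @ [y]) = x" "distinct (as @ [y])"
      using vs(1) eq by (cases as; simp add: path_between_def)+
    ultimately have "path_between E x y (as @ [y]) \<and> length (as @ [y]) \<le> Suc k + 1"
      using vs eq by (simp add: path_between_def)
    then show ?thesis by blast
  next
    case False
    then have "path_between E x y (vs @ [y]) \<and> length (vs @ [y]) \<le> Suc k + 1"
      using vs z(2) by (auto simp: path_between_def successively_append_iff)
    then show ?thesis by blast
  qed
qed

lemma graph_dist_le_walk:
  assumes "(x, y) \<in> adj E ^^ k"
  shows "graph_dist E x y \<le> k"
proof -
  obtain vs where vs: "path_between E x y vs" "length vs \<le> k + 1"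
    using path_of_walk[OF assms] by blast
  then have "length vs = (length vs - 1) + 1"
    by (cases vs) (auto simp: path_between_def)
  with vs(1) have "graph_dist E x y \<le> length vs - 1"
    unfolding graph_dist_def by (intro Least_le) blast
  with vs(2) show ?thesis by simp
qed

lemma adj_relpow_sym: "(x, y) \<in> adj E ^^ k \<Longrightarrow> (y, x) \<in> adj E ^^ k"
proof (induction k arbitrary: y)
  case (Suc k)
  then obtain z where "(x, z) \<in> adj E ^^ k" "(z, y) \<in> adj E" by auto
  with Suc.IH have "(z, x) \<in> adj E ^^ k" "(y, z) \<in> adj E"
    by (auto simp: adj_def insert_commute)
  then show ?case by (rule relpow_Suc_I2[rotated])
qed simp

lemma graphs_line: "E \<in> graphs N \<Longrightarrow> x + 1 < N \<Longrightarrow> {x, x + 1} \<in> E"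
  by (rule subsetD[of "line_edges N"])
     (simp add: graphs_def, unfold line_edges_def verts_def, rule CollectI, rule exI[of _ x], simp)

lemma line_walk:
  assumes "E \<in> graphs N" "x + k < N"
  shows "(x + k, x) \<in> adj E ^^ k"
  using assms(2)
proof (induction k)
  case (Suc k)
  then have "(x + Suc k, x + k) \<in> adj E"
    using graphs_line[OF assms(1), of "x + k"] by (simp add: adj_def insert_commute)
  moreover have "(x + k, x) \<in> adj E ^^ k" using Suc by simp
  ultimately show ?case by (rule relpow_Suc_I2)
qed simp

lemma walk_exists:
  assumes "E \<in> graphs N" "x < N" "y < N"
  shows "\<exists>k<N. (x, y) \<in> adj E ^^ k"
proof (cases "x \<le> y")
  case True
  then have "(x, y) \<in> adj E ^^ (y - x)"
    using line_walk[OF assms(1), of x "y - x"] assms(3) by (auto intro: adj_relpow_sym)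
  then show ?thesis using assms by (intro exI[of _ "y - x"]) auto
next
  case False
  then have "(x, y) \<in> adj E ^^ (x - y)"
    using line_walk[OF assms(1), of y "x - y"] assms(2) by auto
  then show ?thesis using assms by (intro exI[of _ "x - y"]) auto
qed

lemma graph_dist_less:
  assumes "E \<in> graphs N" "x < N" "y < N"
  shows "graph_dist E x y < N"
  using walk_exists[OF assms] graph_dist_le_walk by (meson order_le_less_trans)

lemma shortest_path_exists:
  assumes "E \<in> graphs N" "x < N" "y < N"
  obtains vs where "path_between E x y vs" "length vs = graph_dist E x y + 1"
proof -
  obtain k where "(x, y) \<in> adj E ^^ k" using walk_exists[OF assms] by blast
  then obtain vs where vs: "path_between E x y vs" using path_of_walk by blast
  then have "length vs = (length vs - 1) + 1"
    by (cases vs) (auto simp: path_between_def)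
  with vs have "\<exists>k vs. path_between E x y vs \<and> length vs = k + 1" by blast
  from LeastI_ex[OF this] show thesis
    using that unfolding graph_dist_def by blast
qed

lemma graph_dist_pos:
  assumes "E \<in> graphs N" "x < N" "y < N" "x \<noteq> y"
  shows "graph_dist E x y \<ge> 1"
proof -
  obtain vs where "path_between E x y vs" "length vs = graph_dist E x y + 1"
    using shortest_path_exists[OF assms(1-3)] .
  with \<open>x \<noteq> y\<close> show ?thesis
    by (cases vs rule: remdups_adj.cases) (auto simp: path_between_def)
qed

section \<open>The functional \<open>Hp\<close>\<close>

lemma ereal_ge_1_cases:
  fixes p :: ereal
  assumes "1 \<le> p"
  obtains "p = \<infinity>" | q where "p = ereal q" "q \<ge> 1"
  using assms by (cases p) auto

lemma Hp_le:
  assumes p: "1 \<le> p" and N: "N > 0"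
    and D: "\<And>x y. x < N \<Longrightarrow> y < N \<Longrightarrow> real (graph_dist E x y) \<le> D"
  shows "Hp p N E \<le> D"
  using p
proof (cases p rule: ereal_ge_1_cases)
  case 1
  have "finite {real (graph_dist E x y) | x y. x \<in> verts N \<and> y \<in> verts N}"
    by (rule finite_subset[of _ "(\<lambda>(x, y). real (graph_dist E x y)) ` (verts N \<times> verts N)"])
       (auto simp: verts_def)
  then show ?thesis
    using 1 N D unfolding Hp_def by (force simp: verts_def intro!: Max.boundedI)
next
  case (2 q)
  have D0: "D \<ge> 0" using D[of 0 0] N by simp
  have "(\<Sum>x\<in>verts N. \<Sum>y\<in>verts N. real (graph_dist E x y) powr q)
          \<le> (\<Sum>x\<in>verts N. \<Sum>y\<in>verts N. D powr q)"
    using 2 D by (intro sum_mono powr_mono2) (auto simp: verts_def)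
  also have "\<dots> = real N ^ 2 * D powr q"
    by (simp add: verts_def power2_eq_square)
  finally have "1 / real N ^ 2 * (\<Sum>x\<in>verts N. \<Sum>y\<in>verts N. real (graph_dist E x y) powr q)
      \<le> D powr q"
    using N by (simp add: field_simps)
  then have "Hp p N E \<le> (D powr q) powr (1 / q)"
    using 2 by (auto simp: Hp_def intro!: powr_mono2 divide_nonneg_nonneg sum_nonneg)
  also have "\<dots> = D" using 2 D0 by (simp add: powr_powr)
  finally show ?thesis .
qed

text \<open>
  Markov's inequality for \<open>d\<^sup>p\<close>: a pair with \<open>d > 4 h\<close> contributes more than
  \<open>(4 h)\<^sup>p \<ge> 4 h\<^sup>p\<close>, while the total is at most \<open>N\<^sup>2 h\<^sup>p\<close>. The bound is the same for every \<open>p\<close>,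
  and below a small \<open>Hp\<close> is used only through it, so that the exponent \<open>p\<close> disappears from the
  argument.
\<close>

lemma few_far_pairs:
  assumes p: "1 \<le> p" and N: "N > 0" and h: "h > 0" and H: "Hp p N E \<le> h"
  shows "real (card {(x, y) \<in> verts N \<times> verts N. real (graph_dist E x y) > 4 * h}) \<le> real N ^ 2 / 4"
    (is "real (card ?F) \<le> _")
  using p
proof (cases p rule: ereal_ge_1_cases)
  case 1
  have "finite {real (graph_dist E x y) | x y. x \<in> verts N \<and> y \<in> verts N}"
    by (rule finite_subset[of _ "(\<lambda>(x, y). real (graph_dist E x y)) ` (verts N \<times> verts N)"])
       (auto simp: verts_def)
  then have "real (graph_dist E x y) \<le> h" if "x \<in> verts N" "y \<in> verts N" for x y
  proof -
    have "real (graph_dist E x y) \<le> Hp p N E"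
      unfolding Hp_def 1 using that \<open>finite _\<close> by (simp, intro Max_ge) auto
    with H show ?thesis by simp
  qed
  then have "?F = {}" using h by force
  then show ?thesis by (metis card.empty of_nat_0 divide_nonneg_pos zero_le_power2 zero_less_numeral)
next
  case (2 q)
  let ?S = "\<Sum>x\<in>verts N. \<Sum>y\<in>verts N. real (graph_dist E x y) powr q"
  have S0: "?S \<ge> 0" by (intro sum_nonneg) auto
  have "real (card ?F) * (4 * h) powr q = (\<Sum>z\<in>?F. (4 * h) powr q)" by simp
  also have "\<dots> \<le> (\<Sum>(x, y)\<in>?F. real (graph_dist E x y) powr q)"
    using 2 h by (intro sum_mono) (auto intro!: powr_mono2)
  also have "\<dots> \<le> (\<Sum>(x, y)\<in>verts N \<times> verts N. real (graph_dist E x y) powr q)"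
    by (intro sum_mono2) (auto simp: verts_def)
  also have "\<dots> = ?S" by (simp add: sum.cartesian_product)
  also have "?S \<le> real N ^ 2 * h powr q"
  proof -
    have "1 / real N ^ 2 * ?S = ((1 / real N ^ 2 * ?S) powr (1 / q)) powr q"
      using 2 S0 by (simp add: powr_powr)
    also have "\<dots> = Hp p N E powr q" using 2 by (simp add: Hp_def)
    also have "\<dots> \<le> h powr q"
      using 2 H by (intro powr_mono2) (auto simp: Hp_def)
    finally show ?thesis using N by (simp add: field_simps)
  qed
  finally have "real (card ?F) * 4 powr q * h powr q \<le> real N ^ 2 * h powr q"
    using h by (simp add: powr_mult mult.assoc)
  then have "real (card ?F) * 4 powr q \<le> real N ^ 2"
    using h by simp
  moreover have "real (card ?F) * 4 powr 1 \<le> real (card ?F) * 4 powr q"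
    using 2 by (intro mult_left_mono powr_mono) auto
  ultimately show ?thesis by simp
qed

text \<open>
  Distinct vertices are at distance at least 1, and most pairs are distinct. The value 1/5
  only has to lie below 1/4, so that a pair of distinct vertices is too far apart for
  \<open>few_far_pairs\<close>.
\<close>

lemma Hp_lower_trivial:
  assumes p: "1 \<le> p" and N: "N \<ge> 2" and E: "E \<in> graphs N"
  shows "Hp p N E > 1 / 5"
proof (rule ccontr)
  assume "\<not> Hp p N E > 1 / 5"
  then have H: "Hp p N E \<le> 1 / 5" by simp
  let ?F = "{(x, y) \<in> verts N \<times> verts N. real (graph_dist E x y) > 4 * (1 / 5)}"
  have "verts N \<times> verts N - (\<lambda>x. (x, x)) ` verts N \<subseteq> ?F"
    using graph_dist_pos[OF E] by (force simp: verts_def)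
  then have "card (verts N \<times> verts N - (\<lambda>x. (x, x)) ` verts N) \<le> card ?F"
    by (intro card_mono finite_subset[of ?F "verts N \<times> verts N"]) (auto simp: verts_def)
  moreover have "card (verts N \<times> verts N - (\<lambda>x. (x, x)) ` verts N) = N * N - N"
    by (subst card_Diff_subset) (auto simp: verts_def card_image inj_on_def)
  ultimately have "N * N - N \<le> card ?F" by (simp only:)
  then have "real (N * N - N) \<le> real (card ?F)" by (rule of_nat_mono)
  also have "\<dots> \<le> real N ^ 2 / 4"
    using few_far_pairs[OF p _ _ H] N by simp
  finally have "real N ^ 2 - real N \<le> real N ^ 2 / 4"
    using N by (subst (asm) of_nat_diff) (auto simp: power2_eq_square)
  moreover have "real N ^ 2 \<ge> 2 * real N"
    using N by (simp add: power2_eq_square)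
  ultimately show False using N by simp
qed

section \<open>A small \<open>Hp\<close> forces a heavy set of long edges\<close>

lemma card_nat_window:
  fixes W :: real
  assumes "W \<ge> 0"
  shows "real (card {v :: nat. \<bar>real v - real x\<bar> < W}) \<le> 2 * W + 1"
    and "finite {v :: nat. \<bar>real v - real x\<bar> < W}"
proof -
  let ?A = "{v :: nat. \<bar>real v - real x\<bar> < W}"
  let ?f = "\<lambda>v :: nat. int v - int x"
  have sub: "?f ` ?A \<subseteq> {-\<lfloor>W\<rfloor>..\<lfloor>W\<rfloor>}"
  proof safe
    fix v :: nat
    assume "\<bar>real v - real x\<bar> < W"
    then have "real_of_int (int v - int x) \<le> W" "real_of_int (- (int v - int x)) \<le> W" by auto
    then have "int v - int x \<le> \<lfloor>W\<rfloor>" "- (int v - int x) \<le> \<lfloor>W\<rfloor>"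
      by (simp_all only: le_floor_iff)
    then show "int v - int x \<in> {-\<lfloor>W\<rfloor>..\<lfloor>W\<rfloor>}" by simp
  qed
  have inj: "inj_on ?f ?A" by (auto simp: inj_on_def)
  show fin: "finite ?A"
    using finite_subset[OF sub] inj by (auto simp: finite_image_iff)
  have "card ?A \<le> card {-\<lfloor>W\<rfloor>..\<lfloor>W\<rfloor>}"
    using card_mono[OF _ sub] card_image[OF inj] by simp
  also have "\<dots> = nat (2 * \<lfloor>W\<rfloor> + 1)" by simp
  finally have "real (card ?A) \<le> real (nat (2 * \<lfloor>W\<rfloor> + 1))" by simp
  also have "\<dots> = 2 * real_of_int \<lfloor>W\<rfloor> + 1" using assms by simp
  also have "\<dots> \<le> 2 * W + 1" by simp
  finally show "real (card ?A) \<le> 2 * W + 1" .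
qed

definition reaching :: "graph \<Rightarrow> nat \<Rightarrow> real \<Rightarrow> real \<Rightarrow> nat set" where
  "reaching E N r W =
     {x \<in> verts N. \<exists>y\<in>verts N. \<bar>real y - real x\<bar> \<ge> W \<and> real (graph_dist E x y) \<le> r}"

text \<open>
  A vertex that is not reaching is far from all vertices outside its window, and these are at
  least \<open>N / 2\<close>, because the window contains at most \<open>3 W \<le> N / 2\<close> vertices. There are at most
  \<open>N\<^sup>2 / 4\<close> far pairs, which leaves at most \<open>N / 2\<close> such vertices.
\<close>

lemma many_reaching:
  assumes p: "1 \<le> p" and N: "N > 0" and h: "h > 0" and H: "Hp p N E \<le> h"
    and W: "W \<ge> 1" "6 * W \<le> real N"
  shows "real (card (reaching E N (4 * h) W)) \<ge> real N / 2"
proof -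
  let ?F = "{(x, y) \<in> verts N \<times> verts N. real (graph_dist E x y) > 4 * h}"
  let ?G = "verts N - reaching E N (4 * h) W"
  let ?far = "\<lambda>x. verts N - {y. \<bar>real y - real x\<bar> < W}"
  have far: "real (card (?far x)) \<ge> real N / 2" for x
  proof -
    have "card (verts N) \<le> card (?far x) + card {y :: nat. \<bar>real y - real x\<bar> < W}"
      using diff_card_le_card_Diff[OF card_nat_window(2)[of W x], of "verts N"] W by linarith
    then have "real N \<le> real (card (?far x)) + real (card {y :: nat. \<bar>real y - real x\<bar> < W})"
      by (simp add: verts_def)
    with card_nat_window(1)[of W x] W show ?thesis by linarith
  qed
  have "(SIGMA x:?G. ?far x) \<subseteq> ?F"
    by (auto simp: reaching_def not_less not_le)
  then have "card (SIGMA x:?G. ?far x) \<le> card ?F"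
    by (intro card_mono) (rule finite_subset[of _ "verts N \<times> verts N"], auto simp: verts_def)
  moreover have "card (SIGMA x:?G. ?far x) = (\<Sum>x\<in>?G. card (?far x))"
    by (rule card_SigmaI) (auto simp: verts_def)
  ultimately have "real (\<Sum>x\<in>?G. card (?far x)) \<le> real (card ?F)"
    by (simp only: of_nat_le_iff)
  moreover have "real (card ?G) * (real N / 2) \<le> real (\<Sum>x\<in>?G. card (?far x))"
    using sum_mono[of ?G "\<lambda>_. real N / 2" "\<lambda>x. real (card (?far x))"] far by simp
  ultimately have "real (card ?G) * (real N / 2) \<le> real N ^ 2 / 4"
    using few_far_pairs[OF p N h H] by linarith
  then have "real (card ?G) \<le> real N / 2"
    using N by (simp add: power2_eq_square field_simps)
  moreover have "card ?G + card (reaching E N (4 * h) W) = N"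
  proof -
    have "reaching E N (4 * h) W \<subseteq> verts N" "finite (verts N)" "card (verts N) = N"
      by (auto simp: reaching_def verts_def)
    then show ?thesis
      using card_Diff_subset card_mono finite_subset by (metis le_add_diff_inverse2)
  qed
  then have "real (card ?G) + real (card (reaching E N (4 * h) W)) = real N"
    by (simp only: of_nat_add[symmetric])
  ultimately show ?thesis by linarith
qed

text \<open>
  A function on the vertices can only grow along a path by what the edges of the path allow;
  the path is self-avoiding, so each edge is paid for once.
\<close>

lemma path_increment:
  fixes g :: "nat \<Rightarrow> real" and \<phi> :: "nat set \<Rightarrow> real"
  assumes "vs \<noteq> []" "distinct vs" "successively (\<lambda>u v. {u, v} \<in> E) vs"
    and "\<And>u v. {u, v} \<in> E \<Longrightarrow> g v - g u \<le> \<phi> {u, v}"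
  shows "\<exists>F\<subseteq>E. finite F \<and> \<Union> F \<subseteq> set vs \<and> card F < length vs \<and>
           g (last vs) - g (hd vs) \<le> sum \<phi> F"
  using assms(1-3)
proof (induction vs rule: induct_list012)
  case (2 x)
  then show ?case by (intro exI[of _ "{}"]) auto
next
  case (3 x u vs)
  then obtain F where F: "F \<subseteq> E" "finite F" "\<Union> F \<subseteq> set (u # vs)" "card F < length (u # vs)"
      "g (last (u # vs)) - g (hd (u # vs)) \<le> sum \<phi> F"
    by auto
  have new: "{x, u} \<notin> F" using F(3) 3(4) by auto
  have e: "{x, u} \<in> E" using 3(5) by simp
  have "g (last (x # u # vs)) - g (hd (x # u # vs)) \<le> sum \<phi> (insert {x, u} F)"
    using F(2,5) new assms(4)[OF e] by simp
  then show ?case using F new e by (intro exI[of _ "insert {x, u} F"]) auto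
qed simp

lemma finite_graph: "E \<in> graphs N \<Longrightarrow> finite E"
  using finite_all_edges finite_subset by (auto simp: graphs_def)

text \<open>
  The truncated displacement \<open>min \<bar>v - x\<bar> W\<close> rises from 0 to \<open>W\<close> along a path that leaves
  the window of \<open>x\<close>. It is constant outside the window, so only edges that meet the window
  contribute, and an edge contributes at most its length and at most \<open>W\<close>. The edges shorter
  than \<open>l\<close> account for at most \<open>r l\<close> of the rise. Truncating at \<open>W\<close> is what makes
  one very long edge count no more than an edge of length \<open>W\<close>.
\<close>

lemma window_weight:
  assumes E: "E \<in> graphs N" and x: "x \<in> reaching E N r W" and l: "l \<ge> 0" and W: "W \<ge> 0"
  shows "W - r * l \<le> (\<Sum>e\<in>{e\<in>E. real (edge_length e) \<ge> l}.
           if \<exists>v\<in>e. \<bar>real v - real x\<bar> < W then min (real (edge_length e)) W else 0)"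
proof -
  obtain y where y: "x < N" "y < N" "\<bar>real y - real x\<bar> \<ge> W" "real (graph_dist E x y) \<le> r"
    using x by (auto simp: reaching_def verts_def)
  obtain vs where vs: "path_between E x y vs" "length vs = graph_dist E x y + 1"
    using shortest_path_exists[OF E y(1,2)] .
  define g where "g = (\<lambda>v. min \<bar>real v - real x\<bar> W)"
  define \<psi> where "\<psi> = (\<lambda>e. if real (edge_length e) \<ge> l then
      if \<exists>v\<in>e. \<bar>real v - real x\<bar> < W then min (real (edge_length e)) W else 0 else 0)"
  \<comment> \<open>Edges shorter than \<open>l\<close> are covered by the summand \<open>l\<close>, all others by \<open>\<psi>\<close>.\<close>
  have inc: "g v - g u \<le> l + \<psi> {u, v}" for u v
    using l W unfolding g_def \<psi>_def edge_length_doubleton by (simp add: min_def) linarith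
  have psi0: "\<psi> e \<ge> 0" for e using W by (auto simp: \<psi>_def)
  have "\<exists>F\<subseteq>E. finite F \<and> \<Union> F \<subseteq> set vs \<and> card F < length vs \<and>
      g (last vs) - g (hd vs) \<le> (\<Sum>e\<in>F. l + \<psi> e)"
    using vs by (intro path_increment inc) (auto simp: path_between_def)
  then obtain F where F: "F \<subseteq> E" "finite F" "card F < length vs"
      "g (last vs) - g (hd vs) \<le> (\<Sum>e\<in>F. l + \<psi> e)" by blast
  have "W = g (last vs) - g (hd vs)"
    using vs(1) y(3) W by (auto simp: g_def path_between_def)
  also have "\<dots> \<le> real (card F) * l + sum \<psi> F"
    using F(4) by (simp add: sum.distrib)
  also have "real (card F) * l \<le> r * l"
    using F(3) vs(2) y(4) l by (intro mult_right_mono) auto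
  also have "sum \<psi> F \<le> sum \<psi> E"
    using F psi0 finite_graph[OF E] by (intro sum_mono2) auto
  also have "sum \<psi> E = (\<Sum>e\<in>{e\<in>E. real (edge_length e) \<ge> l}.
           if \<exists>v\<in>e. \<bar>real v - real x\<bar> < W then min (real (edge_length e)) W else 0)"
    using finite_graph[OF E] by (simp add: \<psi>_def sum.inter_filter)
  finally show ?thesis by simp
qed

text \<open>
  Double counting. By the choice \<open>W = 2 \<cdot> 4 h \<cdot> l\<close>, each of the at least \<open>N / 2\<close> reaching vertices has
  truncated edge length at least \<open>W / 2\<close> meeting its window, and an edge meets the windows of at
  most \<open>6 W\<close> vertices, at most \<open>3 W\<close> for each endpoint.
\<close>

lemma small_Hp_truncated_length:
  assumes p: "1 \<le> p" and N: "N > 0" and E: "E \<in> graphs N"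
    and h: "h > 0" and H: "Hp p N E \<le> h"
    and l: "l > 0" and W: "W = 8 * h * l" "W \<ge> 1" "6 * W \<le> real N"
  shows "real N / 24 \<le> (\<Sum>e\<in>{e\<in>E. real (edge_length e) \<ge> l}. min (real (edge_length e)) W)"
    (is "_ \<le> sum ?m ?E")
proof -
  let ?B = "reaching E N (4 * h) W"
  have finE: "finite ?E" using finite_graph[OF E] by simp
  have finB: "finite ?B" by (auto simp: reaching_def verts_def)
  have card_meet: "real (card {x \<in> ?B. \<exists>v\<in>e. \<bar>real v - real x\<bar> < W}) \<le> 6 * W" if "e \<in> E" for e
  proof -
    obtain u v where e: "e = {u, v}" using E \<open>e \<in> E\<close> by (auto simp: graphs_def all_edges_def)
    have "{x \<in> ?B. \<exists>v\<in>e. \<bar>real v - real x\<bar> < W} \<subseteq>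
        {x. \<bar>real x - real u\<bar> < W} \<union> {x. \<bar>real x - real v\<bar> < W}"
      by (auto simp: e abs_minus_commute)
    then have "card {x \<in> ?B. \<exists>v\<in>e. \<bar>real v - real x\<bar> < W} \<le>
        card ({x. \<bar>real x - real u\<bar> < W} \<union> {x. \<bar>real x - real v\<bar> < W})"
      using card_nat_window(2)[of W] W by (intro card_mono) auto
    also have "\<dots> \<le> card {x. \<bar>real x - real u\<bar> < W} + card {x. \<bar>real x - real v\<bar> < W}"
      by (rule card_Un_le)
    finally have "real (card {x \<in> ?B. \<exists>v\<in>e. \<bar>real v - real x\<bar> < W}) \<le>
        real (card {x. \<bar>real x - real u\<bar> < W}) + real (card {x. \<bar>real x - real v\<bar> < W})"
      by (simp only: of_nat_add[symmetric] of_nat_le_iff)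
    with card_nat_window(1)[of W u] card_nat_window(1)[of W v] W(2) show ?thesis by linarith
  qed
  have "real (card ?B) * (W / 2) = (\<Sum>x\<in>?B. W - 4 * h * l)"
    by (simp add: W(1))
  also have "\<dots> \<le> (\<Sum>x\<in>?B. \<Sum>e\<in>?E. if \<exists>v\<in>e. \<bar>real v - real x\<bar> < W then ?m e else 0)"
    using l W(2) by (intro sum_mono window_weight[OF E]) auto
  also have "\<dots> = (\<Sum>e\<in>?E. \<Sum>x\<in>?B. if \<exists>v\<in>e. \<bar>real v - real x\<bar> < W then ?m e else 0)"
    by (rule sum.swap)
  also have "\<dots> = (\<Sum>e\<in>?E. real (card {x \<in> ?B. \<exists>v\<in>e. \<bar>real v - real x\<bar> < W}) * ?m e)"
    using finB by (simp add: sum.inter_filter[symmetric])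
  also have "\<dots> \<le> (\<Sum>e\<in>?E. 6 * W * ?m e)"
    using card_meet W(2) by (intro sum_mono mult_right_mono) auto
  also have "\<dots> = 6 * W * sum ?m ?E" by (simp add: sum_distrib_left)
  finally have "W * (real (card ?B) / 12) \<le> W * sum ?m ?E" by (simp add: algebra_simps)
  then have "real (card ?B) / 12 \<le> sum ?m ?E" using W(2) by simp
  with many_reaching[OF p N h H W(2,3)] show ?thesis by simp
qed

text \<open>
  For \<open>l > 1\<close>, percolation produces the edges counted here, all at once, with probability
  \<open>exp (- long_weight \<gamma> l E)\<close>.
\<close>

definition long_weight :: "real \<Rightarrow> real \<Rightarrow> graph \<Rightarrow> real" where
  "long_weight \<gamma> l E = (\<Sum>e\<in>{e\<in>E. real (edge_length e) \<ge> l}. real (edge_length e) powr \<gamma>)"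

text \<open>
  Convert truncated length into cost, edge by edge. The function \<open>L\<^sup>\<gamma> / min L W\<close> of the edge
  length \<open>L \<ge> l\<close> is at least its value at \<open>L = W\<close> if \<open>\<gamma> < 1\<close>, since shorter edges cost more
  per unit of length and beyond \<open>W\<close> nothing is gained; if \<open>\<gamma> \<ge> 1\<close>, the longer edges cost more per
  unit of length, and it is at least \<open>l powr (\<gamma> - 1)\<close>.
\<close>

lemma small_Hp_long_weight:
  assumes p: "1 \<le> p" and N: "N > 0" and E: "E \<in> graphs N"
    and h: "h > 0" and H: "Hp p N E \<le> h" and \<gamma>: "\<gamma> > 0"
    and l: "l > 0" and W: "W = 8 * h * l" "W \<ge> 1" "6 * W \<le> real N"
  shows "real N / 24 * (if \<gamma> < 1 then W powr (\<gamma> - 1) else l powr (\<gamma> - 1)) \<le> long_weight \<gamma> l E"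
    (is "_ * ?m \<le> _")
proof -
  have edge: "min L W * ?m \<le> L powr \<gamma>" if L: "L \<ge> l" for L :: real
  proof -
    have eq: "t powr \<gamma> = t * t powr (\<gamma> - 1)" if "t > 0" for t :: real
      using that powr_add[of t 1 "\<gamma> - 1"] by simp
    show ?thesis
    proof (cases "\<gamma> < 1")
      case True
      define t where "t = min L W"
      have t: "0 < t" "t \<le> W" "t \<le> L" using L l W by (auto simp: t_def)
      have "t * W powr (\<gamma> - 1) \<le> t * t powr (\<gamma> - 1)"
        using t True by (intro mult_left_mono powr_mono2') auto
      also have "\<dots> \<le> L powr \<gamma>"
        using t \<gamma> by (subst eq[symmetric]) (auto intro!: powr_mono2)
      finally show ?thesis using True by (simp add: t_def)
    next
      case False
      have "min L W * l powr (\<gamma> - 1) \<le> L * L powr (\<gamma> - 1)"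
        using False L l by (intro mult_mono powr_mono2) auto
      then show ?thesis using False eq[of L] L l by simp
    qed
  qed
  have "real N / 24 * ?m \<le> (\<Sum>e\<in>{e\<in>E. real (edge_length e) \<ge> l}. min (real (edge_length e)) W) * ?m"
    using small_Hp_truncated_length[OF p N E h H l W] by (intro mult_right_mono) auto
  also have "\<dots> \<le> long_weight \<gamma> l E"
    unfolding long_weight_def sum_distrib_right by (intro sum_mono edge) auto
  finally show ?thesis .
qed

section \<open>Large deviations of the weight of long edges\<close>

lemma card_long_edges_le: "card (long_edges N) \<le> N\<^sup>2"
proof -
  have "long_edges N \<subseteq> (\<lambda>(x, y). {x, y}) ` (verts N \<times> verts N)"
  proof
    fix e
    assume "e \<in> long_edges N"
    then obtain x y where "e = (\<lambda>(x, y). {x, y}) (x, y)" "(x, y) \<in> verts N \<times> verts N"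
      by (auto simp: long_edges_def all_edges_def)
    then show "e \<in> (\<lambda>(x, y). {x, y}) ` (verts N \<times> verts N)" by (rule image_eqI)
  qed
  then have "card (long_edges N) \<le> card ((\<lambda>(x, y). {x, y}) ` (verts N \<times> verts N))"
    by (intro card_mono) (simp_all add: verts_def)
  also have "\<dots> \<le> card (verts N \<times> verts N)"
    by (intro card_image_le) (auto simp: verts_def)
  finally show ?thesis by (simp add: verts_def power2_eq_square)
qed

lemma finite_long_edges: "finite (long_edges N)"
  using finite_all_edges by (simp add: long_edges_def)

lemma finite_set_percolation: "finite (set_pmf (percolation \<gamma> N))"
  using finite_subset[OF set_percolation_subset finite_graphs] .

text \<open>
  Only half of the weight is put into the exponent, so an edge of length \<open>L \<ge> l\<close> contributes a factor
  \<open>1 + exp (- L\<^sup>\<gamma>) (exp (L\<^sup>\<gamma> / 2) - 1) \<le> 1 + exp (- l\<^sup>\<gamma> / 2)\<close>, and there are at most \<open>N\<^sup>2\<close> edges. Since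
  \<open>l\<close> will be a positive power of \<open>N\<close>, the bound stays of order one: the entropy of the choice
  of long edges is negligible against their cost.
\<close>

lemma long_weight_exp_moment:
  assumes l: "l > 1" and \<gamma>: "\<gamma> > 0"
  shows "measure_pmf.expectation (percolation \<gamma> N) (\<lambda>E. exp (long_weight \<gamma> l E / 2))
           \<le> exp (real N ^ 2 * exp (- (l powr \<gamma>) / 2))"
proof -
  define f :: "nat set \<Rightarrow> bool \<Rightarrow> real" where
    "f = (\<lambda>e present. if present \<and> real (edge_length e) \<ge> l then exp (real (edge_length e) powr \<gamma> / 2) else 1)"
  let ?P = "Pi_pmf (long_edges N) False (\<lambda>e. bernoulli_pmf (exp (- (real (edge_length e) powr \<gamma>))))"
  \<comment> \<open>The line edges, which are always present, are not counted since \<open>l > 1\<close>.\<close>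
  have short: "real (edge_length e) < l" if "e \<in> line_edges N" for e
    using that l by (auto simp: line_edges_def edge_length_doubleton)
  have prod: "exp (long_weight \<gamma> l (line_edges N \<union> {e \<in> long_edges N. \<omega> e}) / 2)
      = (\<Prod>e\<in>long_edges N. f e (\<omega> e))" for \<omega>
  proof -
    have "{e \<in> line_edges N \<union> {e \<in> long_edges N. \<omega> e}. real (edge_length e) \<ge> l}
        = {e \<in> long_edges N. \<omega> e \<and> real (edge_length e) \<ge> l}"
      using short by force
    then have "exp (long_weight \<gamma> l (line_edges N \<union> {e \<in> long_edges N. \<omega> e}) / 2)
        = (\<Prod>e\<in>{e \<in> long_edges N. \<omega> e \<and> real (edge_length e) \<ge> l}. exp (real (edge_length e) powr \<gamma> / 2))"
      using finite_long_edges by (simp add: long_weight_def sum_divide_distrib exp_sum)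
    also have "\<dots> = (\<Prod>e\<in>long_edges N. f e (\<omega> e))"
      using finite_long_edges by (simp add: f_def prod.inter_filter)
    finally show ?thesis .
  qed
  have one: "measure_pmf.expectation (bernoulli_pmf (exp (- (real (edge_length e) powr \<gamma>)))) (f e)
      \<le> exp (exp (- (l powr \<gamma>) / 2))" for e
  proof (cases "real (edge_length e) \<ge> l")
    case True
    let ?L = "real (edge_length e) powr \<gamma>"
    have "measure_pmf.expectation (bernoulli_pmf (exp (- ?L))) (f e)
        = exp (- ?L) * exp (?L / 2) + (1 - exp (- ?L))"
      using True by (subst integral_bernoulli_pmf) (auto simp: f_def)
    also have "exp (- ?L) * exp (?L / 2) = exp (- ?L / 2)"
      by (subst exp_add[symmetric]) simp
    also have "exp (- ?L / 2) + (1 - exp (- ?L)) \<le> 1 + exp (- ?L / 2)" by simp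
    also have "\<dots> \<le> 1 + exp (- (l powr \<gamma>) / 2)"
      using True l \<gamma> by (auto intro!: powr_mono2)
    also have "\<dots> \<le> exp (exp (- (l powr \<gamma>) / 2))" by (rule exp_ge_add_one_self)
    finally show ?thesis .
  next
    case False
    then show ?thesis by (simp add: f_def)
  qed
  have "measure_pmf.expectation (percolation \<gamma> N) (\<lambda>E. exp (long_weight \<gamma> l E / 2))
      = measure_pmf.expectation ?P (\<lambda>\<omega>. \<Prod>e\<in>long_edges N. f e (\<omega> e))"
    by (simp add: percolation_def prod)
  also have "\<dots> = (\<Prod>e\<in>long_edges N.
      measure_pmf.expectation (bernoulli_pmf (exp (- (real (edge_length e) powr \<gamma>)))) (f e))"
    by (intro expectation_prod_Pi_pmf finite_long_edges integrable_measure_pmf_finite)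
       (auto simp: f_def finite_subset[of _ "UNIV :: bool set"])
  also have "\<dots> \<le> (\<Prod>e\<in>long_edges N. exp (exp (- (l powr \<gamma>) / 2)))"
    by (intro prod_mono conjI one Bochner_Integration.integral_nonneg) (auto simp: f_def)
  also have "\<dots> = exp (real (card (long_edges N)) * exp (- (l powr \<gamma>) / 2))"
    by (simp add: exp_of_nat_mult)
  also have "\<dots> \<le> exp (real N ^ 2 * exp (- (l powr \<gamma>) / 2))"
    using card_long_edges_le[of N] by (auto intro!: mult_right_mono simp flip: of_nat_power)
  finally show ?thesis .
qed

lemma long_weight_tail:
  assumes l: "l > 1" and \<gamma>: "\<gamma> > 0"
  shows "measure_pmf.prob (percolation \<gamma> N) {E. long_weight \<gamma> l E \<ge> M}
           \<le> exp (real N ^ 2 * exp (- (l powr \<gamma>) / 2) - M / 2)"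
proof -
  let ?P = "percolation \<gamma> N"
  have "measure_pmf.prob ?P {E. long_weight \<gamma> l E \<ge> M} * exp (M / 2)
      = measure_pmf.expectation ?P (\<lambda>E. exp (M / 2) * indicator {E. long_weight \<gamma> l E \<ge> M} E)"
    by simp
  also have "\<dots> \<le> measure_pmf.expectation ?P (\<lambda>E. exp (long_weight \<gamma> l E / 2))"
    by (intro integral_mono integrable_measure_pmf_finite finite_set_percolation)
       (auto simp: indicator_def)
  also note long_weight_exp_moment[OF l \<gamma>]
  finally show ?thesis by (simp add: exp_diff pos_le_divide_eq)
qed

section \<open>The dyadic graph\<close>

text \<open>
  Distances below \<open>2 ^ K0\<close> are left to the line. The range of scales is a parameter because the
  expensive scales are the short ones if \<open>\<gamma> < 1\<close> and the long ones if \<open>\<gamma> > 1\<close>.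
\<close>

definition dyadic_edges :: "nat \<Rightarrow> nat \<Rightarrow> nat \<Rightarrow> graph" where
  "dyadic_edges N K0 K1 = {{i * 2 ^ k, (i + 1) * 2 ^ k} | i k. K0 \<le> k \<and> k \<le> K1 \<and> (i + 1) * 2 ^ k < N}"

lemma dyadic_edge_adj:
  assumes "dyadic_edges N K0 K1 \<subseteq> E" "K0 \<le> k" "k \<le> K1" "(i + 1) * 2 ^ k < N"
  shows "((i + 1) * 2 ^ k, i * 2 ^ k) \<in> adj E"
proof -
  have "{i * 2 ^ k, (i + 1) * 2 ^ k} \<in> dyadic_edges N K0 K1"
    unfolding dyadic_edges_def using assms(2-4) by blast
  with assms(1) show ?thesis by (auto simp: adj_def insert_commute)
qed

lemma dyadic_coarse_walk:
  assumes S: "dyadic_edges N K0 K1 \<subseteq> E" and K: "K0 \<le> K1"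
  shows "i * 2 ^ K1 < N \<Longrightarrow> (i * 2 ^ K1, 0) \<in> adj E ^^ i"
proof (induction i)
  case (Suc i)
  then have "(i * 2 ^ K1, 0) \<in> adj E ^^ i" by simp
  moreover have "(Suc i * 2 ^ K1, i * 2 ^ K1) \<in> adj E"
    using dyadic_edge_adj[OF S K order_refl, of i] Suc.prems by simp
  ultimately show ?case by (rule relpow_Suc_I2[rotated])
qed simp

text \<open>
  Rounding a multiple of \<open>2 ^ k\<close> down to a multiple of \<open>2 ^ (k + 1)\<close> takes at most one edge, so
  climbing to scale \<open>K1\<close> takes at most \<open>K1 - k\<close> edges. From there one walks down to 0 in steps of
  size \<open>2 ^ K1\<close>. Rounding down, rather than to a nearest multiple, keeps the walk inside the
  vertex set.
\<close>

lemma dyadic_walk: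
  assumes S: "dyadic_edges N K0 K1 \<subseteq> E"
  shows "K0 \<le> k \<Longrightarrow> k \<le> K1 \<Longrightarrow> i * 2 ^ k < N \<Longrightarrow>
     \<exists>j \<le> (K1 - k) + N div 2 ^ K1. (i * 2 ^ k, 0) \<in> adj E ^^ j"
proof (induction "K1 - k" arbitrary: k i)
  case 0
  then have k: "k = K1" by simp
  have "i = i * 2 ^ K1 div 2 ^ K1" by simp
  also have "\<dots> \<le> N div 2 ^ K1" using 0 k by (intro div_le_mono) simp
  finally show ?case using dyadic_coarse_walk[OF S] 0 k by (intro exI[of _ i]) auto
next
  case (Suc m)
  have even: "\<exists>j \<le> (K1 - Suc k) + N div 2 ^ K1. (2 * i' * 2 ^ k, 0) \<in> adj E ^^ j"
    if "2 * i' * 2 ^ k < N" for i'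
    using Suc(1)[of "Suc k" i'] Suc(2-4) that by (simp add: mult_ac)
  have k: "K1 - k = Suc (K1 - Suc k)" using Suc(2) by simp
  show ?case
  proof (cases "even i")
    case True
    then obtain i' where "i = 2 * i'" by blast
    then show ?thesis using even[of i'] Suc(5) k by (metis add_Suc le_Suc_eq)
  next
    case False
    then obtain i' where i: "i = 2 * i' + 1" by (elim oddE)
    then have le: "2 * i' * 2 ^ k \<le> i * 2 ^ k" by simp
    obtain j where j: "j \<le> (K1 - Suc k) + N div 2 ^ K1" "(2 * i' * 2 ^ k, 0) \<in> adj E ^^ j"
      using even[OF le_less_trans[OF le Suc(5)]] by blast
    have "(i * 2 ^ k, 2 * i' * 2 ^ k) \<in> adj E"
      using dyadic_edge_adj[OF S Suc(3,4), of "2 * i'"] Suc(5) unfolding i by simp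
    then have "(i * 2 ^ k, 0) \<in> adj E ^^ Suc j" using j(2) by (rule relpow_Suc_I2)
    then show ?thesis using j(1) k by (intro exI[of _ "Suc j"]) simp
  qed
qed

lemma dyadic_diameter:
  assumes E: "E \<in> graphs N" and S: "dyadic_edges N K0 K1 \<subseteq> E" and K: "K0 \<le> K1"
    and "x < N" "y < N"
  shows "real (graph_dist E x y) \<le> 2 * (2 ^ K0 + real K1 + real N / 2 ^ K1)"
proof -
  have walk: "\<exists>j. real j \<le> 2 ^ K0 + real K1 + real N / 2 ^ K1 \<and> (x, 0) \<in> adj E ^^ j" if x: "x < N" for x
  proof -
    let ?i = "x div 2 ^ K0"
    have x_eq: "?i * 2 ^ K0 + x mod 2 ^ K0 = x" by (rule div_mult_mod_eq)
    then have "?i * 2 ^ K0 < N" using x by linarith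
    from dyadic_walk[OF S order_refl K this]
    obtain j where j: "j \<le> (K1 - K0) + N div 2 ^ K1" "(?i * 2 ^ K0, 0) \<in> adj E ^^ j" by blast
    have "(x, ?i * 2 ^ K0) \<in> adj E ^^ (x mod 2 ^ K0)"
      using line_walk[OF E, of "?i * 2 ^ K0" "x mod 2 ^ K0"] x x_eq by simp
    with j(2) have "(x, 0) \<in> adj E ^^ (x mod 2 ^ K0 + j)"
      by (auto simp: relpow_add)
    moreover have "x mod 2 ^ K0 + j \<le> 2 ^ K0 + K1 + N div 2 ^ K1"
    proof -
      have "x mod 2 ^ K0 < 2 ^ K0" by simp
      with j(1) show ?thesis by linarith
    qed
    then have "real (x mod 2 ^ K0 + j) \<le> real (2 ^ K0 + K1 + N div 2 ^ K1)"
      by (rule of_nat_mono)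
    then have "real (x mod 2 ^ K0 + j) \<le> 2 ^ K0 + real K1 + real (N div 2 ^ K1)"
      by simp
    moreover have "real (N div 2 ^ K1) \<le> real N / 2 ^ K1"
      using of_nat_div_le_of_nat[of N "2 ^ K1", where ?'a = real] by simp
    ultimately show ?thesis by (intro exI[of _ "x mod 2 ^ K0 + j"]) linarith
  qed
  obtain j where j: "real j \<le> 2 ^ K0 + real K1 + real N / 2 ^ K1" "(x, 0) \<in> adj E ^^ j"
    using walk \<open>x < N\<close> by blast
  obtain k where k: "real k \<le> 2 ^ K0 + real K1 + real N / 2 ^ K1" "(y, 0) \<in> adj E ^^ k"
    using walk \<open>y < N\<close> by blast
  have "(x, y) \<in> adj E ^^ (j + k)"
    using j(2) adj_relpow_sym[OF k(2)] by (auto simp: relpow_add)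
  then have "real (graph_dist E x y) \<le> real (j + k)"
    by (intro of_nat_mono graph_dist_le_walk)
  with j(1) k(1) show ?thesis by simp
qed

text \<open>
  At scale \<open>k\<close> there are at most \<open>N / 2 ^ k\<close> edges, each of cost \<open>(2 ^ k)\<^sup>\<gamma>\<close>.
\<close>

lemma dyadic_cost:
  "(\<Sum>e\<in>dyadic_edges N K0 K1. real (edge_length e) powr \<gamma>)
           \<le> real N * (\<Sum>k=K0..K1. (2 ^ k) powr (\<gamma> - 1))"
proof -
  let ?I = "SIGMA k:{K0..K1}. {i. (i + 1) * 2 ^ k < N}"
  let ?f = "\<lambda>(k, i). {i * 2 ^ k, (i + 1) * 2 ^ k :: nat}"
  have sub: "{i. (i + 1) * 2 ^ k < N} \<subseteq> {..<N div 2 ^ k}" for k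
  proof
    fix i
    assume "i \<in> {i. (i + 1) * 2 ^ k < N}"
    then have "(i + 1) * 2 ^ k div 2 ^ k \<le> N div 2 ^ k" by (intro div_le_mono) simp
    then show "i \<in> {..<N div 2 ^ k}" by simp
  qed
  have fin: "finite {i. (i + 1) * 2 ^ k < N}" for k
    using finite_subset[OF sub] by blast
  have finI: "finite ?I" using fin by (intro finite_SigmaI) auto
  have len: "real (edge_length {i * 2 ^ k, (i + 1) * 2 ^ k}) = 2 ^ k" for k i :: nat
    by (simp add: edge_length_doubleton algebra_simps)
  have count: "real (card {i. (i + 1) * 2 ^ k < N}) * (2 ^ k) powr \<gamma> \<le> real N * (2 ^ k) powr (\<gamma> - 1)" for k
  proof -
    have "card {i. (i + 1) * 2 ^ k < N} \<le> N div 2 ^ k"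
      using card_mono[OF _ sub[of k]] by simp
    then have "real (card {i. (i + 1) * 2 ^ k < N}) \<le> real (N div 2 ^ k)" by simp
    also have "\<dots> \<le> real N / 2 ^ k" using of_nat_div_le_of_nat[of N "2 ^ k", where ?'a = real] by simp
    finally have "real (card {i. (i + 1) * 2 ^ k < N}) * (2 ^ k) powr \<gamma> \<le> real N / 2 ^ k * (2 ^ k) powr \<gamma>"
      by (rule mult_right_mono) simp
    then show ?thesis by (simp add: powr_diff)
  qed
  have "dyadic_edges N K0 K1 = ?f ` ?I"
  proof (intro equalityI subsetI)
    fix e
    assume "e \<in> dyadic_edges N K0 K1"
    then obtain i k where "e = ?f (k, i)" "(k, i) \<in> ?I"
      by (auto simp: dyadic_edges_def)
    then show "e \<in> ?f ` ?I" by (rule image_eqI)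
  next
    fix e
    assume "e \<in> ?f ` ?I"
    then obtain k i where "e = ?f (k, i)" "(k, i) \<in> ?I" by blast
    then have "e = {i * 2 ^ k, (i + 1) * 2 ^ k}" "K0 \<le> k \<and> k \<le> K1 \<and> (i + 1) * 2 ^ k < N"
      by simp_all
    then show "e \<in> dyadic_edges N K0 K1" unfolding dyadic_edges_def by blast
  qed
  then have "(\<Sum>e\<in>dyadic_edges N K0 K1. real (edge_length e) powr \<gamma>)
      \<le> (\<Sum>z\<in>?I. real (edge_length (?f z)) powr \<gamma>)"
    using sum_image_le[OF finI, of "\<lambda>e. real (edge_length e) powr \<gamma>" ?f] by (simp add: o_def)
  also have "\<dots> = (\<Sum>(k, i)\<in>?I. (2 ^ k) powr \<gamma>)"
    by (intro sum.cong refl) (auto simp only: len split: prod.split)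
  also have "\<dots> = (\<Sum>k=K0..K1. real (card {i. (i + 1) * 2 ^ k < N}) * (2 ^ k) powr \<gamma>)"
    by (subst sum.Sigma[symmetric]) (use fin in auto)
  also have "\<dots> \<le> (\<Sum>k=K0..K1. real N * (2 ^ k) powr (\<gamma> - 1))"
    by (intro sum_mono count)
  finally show ?thesis by (simp add: sum_distrib_left)
qed

section \<open>Lower bounds on the partition function\<close>

lemma prob_contains:
  assumes S: "S \<subseteq> all_edges N"
  shows "measure_pmf.prob (percolation \<gamma> N) {E. S \<subseteq> E}
           \<ge> exp (- (\<Sum>e\<in>S. real (edge_length e) powr \<gamma>))"
proof -
  let ?P = "Pi_pmf (long_edges N) False (\<lambda>e. bernoulli_pmf (exp (- (real (edge_length e) powr \<gamma>))))"
  let ?B = "\<lambda>e. if e \<in> S then {True} else UNIV"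
  have finS: "finite S" using S finite_all_edges finite_subset by blast
  \<comment> \<open>Edges of length 1 are present with probability one.\<close>
  have short: "e \<in> line_edges N" if "e \<in> S" "e \<notin> long_edges N" for e
  proof -
    have "e \<in> all_edges N" using that S by blast
    then obtain x y where e: "e = {x, y}" "x < N" "y < N" "x < y"
      unfolding all_edges_def verts_def
      by (smt (verit) atLeastLessThan_iff insert_commute linorder_neqE_nat mem_Collect_eq)
    have "real (edge_length e) \<le> 1"
      using that S by (auto simp: long_edges_def)
    then have "y = x + 1" using e by (simp add: edge_length_doubleton)
    then show ?thesis using e unfolding line_edges_def verts_def by auto
  qed
  have "exp (- (\<Sum>e\<in>S. real (edge_length e) powr \<gamma>))
      \<le> exp (- (\<Sum>e\<in>S \<inter> long_edges N. real (edge_length e) powr \<gamma>))"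
    using finS by (auto intro!: sum_mono2)
  also have "\<dots> = (\<Prod>e\<in>long_edges N \<inter> S. exp (- (real (edge_length e) powr \<gamma>)))"
    using finS by (simp add: exp_sum sum_negf[symmetric] Int_commute)
  also have "\<dots> = (\<Prod>e\<in>long_edges N.
      measure_pmf.prob (bernoulli_pmf (exp (- (real (edge_length e) powr \<gamma>)))) (?B e))"
    unfolding prod.inter_restrict[OF finite_long_edges]
    by (intro prod.cong) (auto simp: measure_pmf_single)
  also have "\<dots> = measure_pmf.prob ?P (Pi (long_edges N) ?B)"
    by (rule measure_Pi_pmf_Pi[OF finite_long_edges, symmetric])
  also have "\<dots> \<le> measure_pmf.prob ?P {\<omega>. S \<subseteq> line_edges N \<union> {e \<in> long_edges N. \<omega> e}}"
    by (rule measure_pmf.finite_measure_mono) (use short in \<open>force simp: Pi_iff\<close>)+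
  also have "\<dots> = measure_pmf.prob (percolation \<gamma> N) {E. S \<subseteq> E}"
    by (simp add: percolation_def vimage_def)
  finally show ?thesis .
qed

lemma partition_fun_ge:
  assumes D: "\<And>E. E \<in> graphs N \<Longrightarrow> E \<in> A \<Longrightarrow> Hp p N E \<le> D"
    and q: "measure_pmf.prob (percolation \<gamma> N) A \<ge> exp (- c)"
  shows "partition_fun \<gamma> b p N \<ge> exp (- (real N powr b * D) - c)"
proof -
  let ?P = "percolation \<gamma> N"
  have "exp (- (real N powr b * D) - c) = exp (- (real N powr b * D)) * exp (- c)"
    by (simp add: exp_diff exp_minus divide_inverse)
  also have "\<dots> \<le> exp (- (real N powr b * D)) * measure_pmf.prob ?P A"
    using q by simp
  also have "\<dots> = measure_pmf.expectation ?P (\<lambda>E. exp (- (real N powr b * D)) * indicator A E)"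
    by simp
  also have "\<dots> \<le> partition_fun \<gamma> b p N"
    unfolding partition_fun_def
  proof (rule integral_mono_AE)
    show "AE E in measure_pmf ?P. exp (- (real N powr b * D)) * indicator A E
        \<le> exp (- (real N powr b) * Hp p N E)"
      using set_percolation_subset D
      by (auto simp: AE_measure_pmf_iff indicator_def intro!: mult_left_mono)
  qed (intro integrable_measure_pmf_finite finite_set_percolation)+
  finally show ?thesis .
qed

lemma partition_fun_ge_trivial:
  assumes "1 \<le> p" "N > 0"
  shows "partition_fun \<gamma> b p N \<ge> exp (- (real N powr (b + 1)))"
proof -
  have "exp (- (real N powr b * real N) - 0) \<le> partition_fun \<gamma> b p N"
  proof (rule partition_fun_ge[where A = UNIV])
    fix E assume "E \<in> graphs N"
    then show "Hp p N E \<le> real N"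
      using graph_dist_less assms by (intro Hp_le) (auto intro: less_imp_le)
  qed (simp add: measure_pmf.prob_space)
  then show ?thesis using assms by (simp add: powr_add)
qed

lemma partition_fun_ge_dyadic:
  assumes "1 \<le> p" "N > 0" "K0 \<le> K1"
  shows "partition_fun \<gamma> b p N \<ge>
     exp (- (real N powr b * (2 * (2 ^ K0 + real K1 + real N / 2 ^ K1)))
          - real N * (\<Sum>k=K0..K1. (2 ^ k) powr (\<gamma> - 1)))"
proof (rule partition_fun_ge[where A = "{E. dyadic_edges N K0 K1 \<subseteq> E}"])
  fix E
  assume "E \<in> graphs N" "E \<in> {E. dyadic_edges N K0 K1 \<subseteq> E}"
  then show "Hp p N E \<le> 2 * (2 ^ K0 + real K1 + real N / 2 ^ K1)"
    using assms dyadic_diameter by (intro Hp_le) auto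
next
  have "{i * 2 ^ k, (i + 1) * 2 ^ k} \<in> all_edges N" if "(i + 1) * 2 ^ k < N" for i k
  proof -
    have "i * 2 ^ k < (i + 1) * 2 ^ k" by simp
    then have "i * 2 ^ k < N" "i * 2 ^ k \<noteq> (i + 1) * 2 ^ k" using that by linarith+
    with that show ?thesis unfolding all_edges_def verts_def atLeastLessThan_iff by blast
  qed
  then have "dyadic_edges N K0 K1 \<subseteq> all_edges N" by (auto simp only: dyadic_edges_def)
  from prob_contains[OF this, of \<gamma>]
  show "exp (- (real N * (\<Sum>k=K0..K1. (2 ^ k) powr (\<gamma> - 1))))
      \<le> measure_pmf.prob (percolation \<gamma> N) {E. dyadic_edges N K0 K1 \<subseteq> E}"
    using dyadic_cost[where \<gamma> = \<gamma>] by (meson exp_le_cancel_iff neg_le_iff_le order_trans)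
qed

lemma gibbs_prob_le:
  assumes A: "A \<subseteq> graphs N" and H: "\<And>E. E \<in> A \<Longrightarrow> Hp p N E \<ge> m"
  shows "measure_pmf.prob (gibbs \<gamma> b p N) A
    \<le> exp (- (real N powr b * m)) * measure_pmf.prob (percolation \<gamma> N) A / partition_fun \<gamma> b p N"
proof -
  have fin: "finite A" using A finite_graphs finite_subset by blast
  have "measure_pmf.prob (gibbs \<gamma> b p N) A = (\<Sum>E\<in>A. pmf (gibbs \<gamma> b p N) E)"
    by (rule measure_measure_pmf_finite[OF fin])
  also have "\<dots> \<le> (\<Sum>E\<in>A. 1 / partition_fun \<gamma> b p N * exp (- (real N powr b * m)) * pmf (percolation \<gamma> N) E)"
    unfolding pmf_gibbs using H less_imp_le[OF partition_fun_pos]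
    by (intro sum_mono mult_right_mono mult_left_mono) (auto intro!: mult_left_mono)
  also have "\<dots> = exp (- (real N powr b * m)) * measure_pmf.prob (percolation \<gamma> N) A / partition_fun \<gamma> b p N"
    by (simp add: measure_measure_pmf_finite[OF fin] sum_distrib_left sum_divide_distrib)
  finally show ?thesis .
qed

section \<open>The balance of cost and energy\<close>

text \<open>
  For \<open>0 < a < 1\<close> and to leading order, \<open>N powr cost_exponent \<gamma> a\<close> is the cost of the cheapest
  set of long edges that brings \<open>Hp\<close> down to \<open>N powr a\<close>: \<open>1 - a (1 - \<gamma>)\<close> if \<open>\<gamma> < 1\<close>, and \<open>\<gamma> - a (\<gamma> - 1)\<close> if \<open>\<gamma> > 1\<close>.
\<close>

definition cost_exponent :: "real \<Rightarrow> real \<Rightarrow> real" where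
  "cost_exponent \<gamma> a = max 1 \<gamma> - a * \<bar>1 - \<gamma>\<bar>"

lemma cost_exponent_pos:
  assumes "\<gamma> > 0" "a \<le> 1"
  shows "cost_exponent \<gamma> a > 0"
proof -
  have "a * \<bar>1 - \<gamma>\<bar> \<le> 1 * \<bar>1 - \<gamma>\<bar>" using assms by (intro mult_right_mono) auto
  then show ?thesis using assms by (auto simp: cost_exponent_def)
qed

lemma cost_exponent_strict_antimono:
  assumes "\<gamma> \<noteq> 1" "a < a'"
  shows "cost_exponent \<gamma> a' < cost_exponent \<gamma> a"
  using assms by (simp add: cost_exponent_def)

lemma \<alpha>_range: "0 \<le> \<alpha> \<gamma> b" "\<alpha> \<gamma> b \<le> 1"
  by (auto simp: \<alpha>_def)

text \<open>
  The number \<open>\<alpha> \<gamma> b\<close> is the solution \<open>a\<close> of \<open>cost_exponent \<gamma> a = b + a\<close>, clipped to \<open>[0, 1]\<close>: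
  it balances the cost of the long edges against the energy \<open>N powr b * N powr a\<close>. The left-hand
  side decreases in \<open>a\<close> and the right-hand side increases, so clipping at 0 preserves only \<open>\<le>\<close>,
  and clipping at 1 only \<open>\<ge>\<close>.
\<close>

lemma cost_exponent_\<alpha>_le:
  assumes "\<gamma> > 0" "\<alpha> \<gamma> b < 1"
  shows "cost_exponent \<gamma> (\<alpha> \<gamma> b) \<le> b + \<alpha> \<gamma> b"
proof (cases "\<gamma> < 1")
  case True
  then have "(1 - b) / (2 - \<gamma>) \<le> \<alpha> \<gamma> b" using assms by (auto simp: \<alpha>_def)
  then show ?thesis using True by (simp add: cost_exponent_def field_simps)
next
  case False
  then have "(\<gamma> - b) / \<gamma> \<le> \<alpha> \<gamma> b" using assms by (auto simp: \<alpha>_def)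
  then show ?thesis using False assms by (simp add: cost_exponent_def field_simps)
qed

lemma cost_exponent_\<alpha>_ge:
  assumes "\<gamma> > 0" "\<alpha> \<gamma> b > 0"
  shows "b + \<alpha> \<gamma> b \<le> cost_exponent \<gamma> (\<alpha> \<gamma> b)"
proof (cases "\<gamma> < 1")
  case True
  then have "(1 - b) / (2 - \<gamma>) \<ge> \<alpha> \<gamma> b" using assms by (auto simp: \<alpha>_def)
  then show ?thesis using True by (simp add: cost_exponent_def field_simps)
next
  case False
  then have "(\<gamma> - b) / \<gamma> \<ge> \<alpha> \<gamma> b" using assms by (auto simp: \<alpha>_def)
  then show ?thesis using False assms by (simp add: cost_exponent_def field_simps)
qed

section \<open>The partition function at the optimal scale\<close>

lemma ex_dyadic_bracket:
  fixes t :: real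
  assumes "t \<ge> 1"
  obtains K :: nat where "2 ^ K \<le> t" "t < 2 * 2 ^ K" "real K \<le> log 2 t"
proof -
  define K where "K = nat \<lfloor>log 2 t\<rfloor>"
  have "log 2 t \<ge> 0" using assms by simp
  then have K: "real K \<le> log 2 t" "log 2 t < real (Suc K)" unfolding K_def by linarith+
  have "2 ^ K \<le> t" using K(1) assms by (simp add: le_log_iff powr_realpow)
  moreover have "t < 2 * 2 ^ K"
    using K(2) assms by (subst (asm) log_less_iff) (auto simp: powr_realpow simp del: of_nat_Suc)
  ultimately show thesis using K(1) that by blast
qed

text \<open>
  If \<open>\<gamma> < 1\<close>, the cost of the dyadic edges is dominated by the smallest scale, and long edges are
  cheap: take the scales from \<open>N powr a\<close> up to \<open>N\<close>. If \<open>\<gamma> \<ge> 1\<close>, it is dominated by the largest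
  scale: take the scales from 1 up to \<open>N powr (1 - a)\<close>. In both cases the diameter is of order
  \<open>N powr a\<close> and the cost of order \<open>N powr cost_exponent \<gamma> a\<close>, up to the logarithmic number of scales.
\<close>

lemma partition_fun_ge_cost_exponent:
  assumes p: "1 \<le> p" and \<gamma>: "\<gamma> > 0" and N: "N > 0" and a: "0 \<le> a" "a \<le> 1"
  shows "partition_fun \<gamma> b p N \<ge>
    exp (- ((1 + log 2 (real N)) * (6 * real N powr (b + a) + 2 * real N powr cost_exponent \<gamma> a)))"
proof -
  define \<Lambda> where "\<Lambda> = 1 + log 2 (real N)"
  define A where "A = real N powr a"
  have A1: "A \<ge> 1" using N a by (simp add: A_def ge_one_powr_ge_zero)
  have \<Lambda>1: "\<Lambda> \<ge> 1" using N by (simp add: \<Lambda>_def)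
  have \<Lambda>A: "\<Lambda> * A \<ge> A" "\<Lambda> * A \<ge> \<Lambda>" using A1 \<Lambda>1 by (simp_all add: mult_le_cancel_right1 mult_le_cancel_left1)
  have *: "\<exists>K0 K1. K0 \<le> K1 \<and> 2 * (2 ^ K0 + real K1 + real N / 2 ^ K1) \<le> 6 * (\<Lambda> * A) \<and>
      real K1 + 1 \<le> \<Lambda> \<and> (\<forall>k\<in>{K0..K1}. real N * (2 ^ k) powr (\<gamma> - 1) \<le> 2 * real N powr cost_exponent \<gamma> a)"
  proof (cases "\<gamma> < 1")
    case True
    \<comment> \<open>Rounding to powers of 2 costs the factor \<open>2 powr (1 - \<gamma>) \<le> 2\<close> in \<open>cost\<close> below.\<close>
    obtain K0 where K0: "2 ^ K0 \<le> A" "A < 2 * 2 ^ K0" using A1 by (rule ex_dyadic_bracket)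
    obtain K1 where K1: "2 ^ K1 \<le> real N" "real N < 2 * 2 ^ K1" "real K1 \<le> log 2 (real N)"
      by (rule ex_dyadic_bracket[of "real N"]) (use N in auto)
    have "A \<le> real N" using powr_mono[of a 1 "real N"] N a by (simp add: A_def)
    then have "(2 :: real) ^ K0 < 2 ^ Suc K1" using K0(1) K1(2) by simp
    then have K: "K0 \<le> K1" using power_less_imp_less_exp[of "2 :: real" K0 "Suc K1"] by simp
    have dist: "2 * (2 ^ K0 + real K1 + real N / 2 ^ K1) \<le> 6 * (\<Lambda> * A)"
    proof -
      have "real N / 2 ^ K1 \<le> 2" using K1(2) by (simp add: field_simps)
      with K0(1) K1(3) \<Lambda>A A1 \<Lambda>1 show ?thesis unfolding \<Lambda>_def by argo
    qed
    have cost: "real N * (2 ^ k) powr (\<gamma> - 1) \<le> 2 * real N powr cost_exponent \<gamma> a" if "k \<ge> K0" for k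
    proof -
      have "(2 :: real) ^ K0 \<le> 2 ^ k" using that by simp
      then have "A / 2 \<le> 2 ^ k" using K0(2) by linarith
      then have "(2 ^ k) powr (\<gamma> - 1) \<le> (A / 2) powr (\<gamma> - 1)"
        using A1 True by (intro powr_mono2') auto
      also have "\<dots> = A powr (\<gamma> - 1) * 2 powr (1 - \<gamma>)"
        using A1 by (simp add: powr_divide powr_minus_divide[symmetric] divide_powr_uminus)
      also have "\<dots> \<le> A powr (\<gamma> - 1) * 2"
        using powr_mono[of "1 - \<gamma>" 1 "2 :: real"] \<gamma> by (intro mult_left_mono) auto
      finally have "real N * (2 ^ k) powr (\<gamma> - 1) \<le> real N * (A powr (\<gamma> - 1) * 2)"
        by (rule mult_left_mono) simp
      also have "\<dots> = 2 * (real N powr 1 * real N powr (a * (\<gamma> - 1)))"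
        using N by (simp add: A_def powr_powr)
      also have "\<dots> = 2 * real N powr cost_exponent \<gamma> a"
        unfolding powr_add[symmetric] using True by (simp add: cost_exponent_def algebra_simps)
      finally show ?thesis .
    qed
    show ?thesis using K dist cost K1(3) by (intro exI[of _ K0] exI[of _ K1]) (auto simp: \<Lambda>_def)
  next
    case False
    have "real N powr (1 - a) \<ge> 1" using N a by (simp add: ge_one_powr_ge_zero)
    then obtain K1 where K1: "2 ^ K1 \<le> real N powr (1 - a)" "real N powr (1 - a) < 2 * 2 ^ K1"
        "real K1 \<le> log 2 (real N powr (1 - a))" by (rule ex_dyadic_bracket)
    have "log 2 (real N powr (1 - a)) = (1 - a) * log 2 (real N)" using N by (simp add: log_powr)
    also have "\<dots> \<le> 1 * log 2 (real N)" using N a by (intro mult_right_mono) auto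
    finally have K1': "real K1 \<le> log 2 (real N)" using K1(3) by simp
    have "real N = A * real N powr (1 - a)"
      using N by (simp add: A_def powr_add[symmetric])
    also have "\<dots> \<le> A * (2 * 2 ^ K1)" using K1(2) A1 by (intro mult_left_mono) auto
    finally have "real N / 2 ^ K1 \<le> 2 * A" by (simp add: field_simps)
    then have dist: "2 * (2 ^ 0 + real K1 + real N / 2 ^ K1) \<le> 6 * (\<Lambda> * A)"
      using K1' \<Lambda>A A1 \<Lambda>1 unfolding \<Lambda>_def power_0 by argo
    have cost: "real N * (2 ^ k) powr (\<gamma> - 1) \<le> 2 * real N powr cost_exponent \<gamma> a" if "k \<le> K1" for k
    proof -
      have "(2 :: real) ^ k \<le> 2 ^ K1" using that by simp
      then have "(2 :: real) ^ k \<le> real N powr (1 - a)" using K1(1) by linarith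
      then have "(2 ^ k) powr (\<gamma> - 1) \<le> (real N powr (1 - a)) powr (\<gamma> - 1)"
        using False by (intro powr_mono2) auto
      then have "real N * (2 ^ k) powr (\<gamma> - 1) \<le> real N powr 1 * real N powr ((1 - a) * (\<gamma> - 1))"
        using N by (simp add: powr_powr)
      also have "\<dots> = real N powr cost_exponent \<gamma> a"
        unfolding powr_add[symmetric] using False by (simp add: cost_exponent_def algebra_simps)
      finally show ?thesis by (rule order_trans) simp
    qed
    show ?thesis using dist cost K1' by (intro exI[of _ 0] exI[of _ K1]) (auto simp: \<Lambda>_def)
  qed
  then obtain K0 K1 where K: "K0 \<le> K1" "2 * (2 ^ K0 + real K1 + real N / 2 ^ K1) \<le> 6 * (\<Lambda> * A)"
      "real K1 + 1 \<le> \<Lambda>" "\<And>k. k \<in> {K0..K1} \<Longrightarrow> real N * (2 ^ k) powr (\<gamma> - 1) \<le> 2 * real N powr cost_exponent \<gamma> a"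
    by blast
  have "real N powr b * (2 * (2 ^ K0 + real K1 + real N / 2 ^ K1)) \<le> real N powr b * (6 * (\<Lambda> * A))"
    using K(2) by (rule mult_left_mono) simp
  also have "\<dots> = \<Lambda> * (6 * real N powr (b + a))" by (simp add: A_def powr_add)
  finally have 1: "real N powr b * (2 * (2 ^ K0 + real K1 + real N / 2 ^ K1)) \<le> \<Lambda> * (6 * real N powr (b + a))" .
  have "real N * (\<Sum>k=K0..K1. (2 ^ k) powr (\<gamma> - 1)) \<le> (\<Sum>k=K0..K1. 2 * real N powr cost_exponent \<gamma> a)"
    unfolding sum_distrib_left by (rule sum_mono) (rule K(4))
  also have "\<dots> = real (Suc K1 - K0) * (2 * real N powr cost_exponent \<gamma> a)" by simp
  also have "\<dots> \<le> \<Lambda> * (2 * real N powr cost_exponent \<gamma> a)"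
    using K(1,3) by (intro mult_right_mono) auto
  finally have "- (\<Lambda> * (6 * real N powr (b + a) + 2 * real N powr cost_exponent \<gamma> a))
      \<le> - (real N powr b * (2 * (2 ^ K0 + real K1 + real N / 2 ^ K1)))
          - real N * (\<Sum>k=K0..K1. (2 ^ k) powr (\<gamma> - 1))"
    using 1 by (simp add: distrib_left)
  then have "exp (- (\<Lambda> * (6 * real N powr (b + a) + 2 * real N powr cost_exponent \<gamma> a)))
      \<le> exp (- (real N powr b * (2 * (2 ^ K0 + real K1 + real N / 2 ^ K1)))
          - real N * (\<Sum>k=K0..K1. (2 ^ k) powr (\<gamma> - 1)))"
    by (simp only: exp_le_cancel_iff)
  also have "\<dots> \<le> partition_fun \<gamma> b p N" by (rule partition_fun_ge_dyadic[OF p N K(1)])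
  finally show ?thesis unfolding \<Lambda>_def .
qed

text \<open>
  If \<open>\<alpha> \<gamma> b < 1\<close>, cost and energy of the dyadic graph with \<open>a = \<alpha> \<gamma> b\<close> are both at most
  \<open>N powr (b + \<alpha> \<gamma> b)\<close> up to logarithms; if \<open>\<alpha> \<gamma> b = 1\<close>, no long edge is needed, because \<open>Hp \<le> N\<close>
  always holds.
\<close>

lemma partition_fun_eventually_ge:
  assumes p: "1 \<le> p" and \<gamma>: "\<gamma> > 0" and \<delta>: "\<delta> > 0"
  shows "\<forall>\<^sub>F N in sequentially. partition_fun \<gamma> b p N \<ge> exp (- (real N powr (b + \<alpha> \<gamma> b + \<delta>)))"
proof (cases "\<alpha> \<gamma> b < 1")
  case True
  have "\<forall>\<^sub>F N :: nat in sequentially. 8 * (1 + log 2 (real N)) \<le> real N powr \<delta>"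
    using \<delta> by real_asymp
  then show ?thesis using eventually_ge_at_top[of 1]
  proof eventually_elim
    case (elim N)
    let ?a = "\<alpha> \<gamma> b"
    have "real N powr cost_exponent \<gamma> ?a \<le> real N powr (b + ?a)"
      using elim cost_exponent_\<alpha>_le[OF \<gamma> True] by (intro powr_mono) auto
    then have "(1 + log 2 (real N)) * (6 * real N powr (b + ?a) + 2 * real N powr cost_exponent \<gamma> ?a)
        \<le> (1 + log 2 (real N)) * (8 * real N powr (b + ?a))"
      using elim by (intro mult_left_mono) auto
    also have "\<dots> = 8 * (1 + log 2 (real N)) * real N powr (b + ?a)" by simp
    also have "\<dots> \<le> real N powr \<delta> * real N powr (b + ?a)"
      using elim by (intro mult_right_mono) auto
    also have "\<dots> = real N powr (b + ?a + \<delta>)" by (simp add: powr_add)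
    finally have "exp (- (real N powr (b + ?a + \<delta>)))
        \<le> exp (- ((1 + log 2 (real N)) * (6 * real N powr (b + ?a) + 2 * real N powr cost_exponent \<gamma> ?a)))"
      by (simp only: exp_le_cancel_iff neg_le_iff_le)
    also have "\<dots> \<le> partition_fun \<gamma> b p N"
      using \<alpha>_range elim by (intro partition_fun_ge_cost_exponent[OF p \<gamma>]) auto
    finally show ?case .
  qed
next
  case False
  then have 1: "\<alpha> \<gamma> b = 1" using \<alpha>_range[of \<gamma> b] by simp
  show ?thesis using eventually_ge_at_top[of 1]
  proof eventually_elim
    case (elim N)
    have "real N powr (b + 1) \<le> real N powr (b + 1 + \<delta>)"
      using elim \<delta> by (intro powr_mono) auto
    then have "exp (- (real N powr (b + 1 + \<delta>))) \<le> exp (- (real N powr (b + 1)))"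
      by (simp only: exp_le_cancel_iff neg_le_iff_le)
    also have "\<dots> \<le> partition_fun \<gamma> b p N"
      using elim by (intro partition_fun_ge_trivial[OF p]) auto
    finally show ?case unfolding 1 .
  qed
qed

section \<open>Concentration\<close>

text \<open>
  Apply \<open>small_Hp_long_weight\<close> with \<open>h = N powr a\<close> and \<open>l = N powr \<beta>\<close>, hence \<open>W = 8 N powr (a + \<beta>)\<close>.
  The window condition forces \<open>\<beta> < 1 - a\<close>. The exponent of the resulting weight approaches
  \<open>cost_exponent \<gamma> a\<close> when \<open>\<beta>\<close> is small if \<open>\<gamma> < 1\<close>, and when \<open>\<beta>\<close> is close to \<open>1 - a\<close> if \<open>\<gamma> > 1\<close>.
\<close>

lemma percolation_small_Hp:
  assumes p: "1 \<le> p" and \<gamma>: "\<gamma> > 0" "\<gamma> \<noteq> 1" and a: "0 < a" "a < 1" and \<kappa>: "\<kappa> < cost_exponent \<gamma> a"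
  shows "\<forall>\<^sub>F N in sequentially.
    measure_pmf.prob (percolation \<gamma> N) {E \<in> graphs N. Hp p N E \<le> real N powr a} \<le> exp (1 - real N powr \<kappa>)"
proof -
  define expo where "expo = (\<lambda>\<beta>. if \<gamma> < 1 then 1 + (a + \<beta>) * (\<gamma> - 1) else 1 + \<beta> * (\<gamma> - 1))"
  define d where "d = cost_exponent \<gamma> a - \<kappa>"
  have "d > 0" using \<kappa> by (simp add: d_def)
  have "\<exists>\<beta>>0. \<beta> < 1 - a \<and> \<kappa> < expo \<beta>"
  proof (cases "\<gamma> < 1")
    case True
    define \<beta> where "\<beta> = min ((1 - a) / 2) (d / 2)"
    have "\<beta> \<le> (1 - a) / 2" unfolding \<beta>_def by (rule min.cobounded1)
    then have \<beta>: "\<beta> > 0" "\<beta> < 1 - a" "\<beta> \<le> d / 2" using a \<open>d > 0\<close> by (auto simp: \<beta>_def)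
    have "\<beta> * (1 - \<gamma>) \<le> \<beta> * 1" using \<beta>(1) \<gamma> by (intro mult_left_mono) auto
    then have "\<kappa> < expo \<beta>" using True \<beta>(3) \<open>d > 0\<close> by (simp add: expo_def d_def cost_exponent_def algebra_simps)
    with \<beta> show ?thesis by blast
  next
    case False
    define \<eta> where "\<eta> = min ((1 - a) / 2) (d / (2 * (\<gamma> - 1)))"
    have "\<eta> \<le> (1 - a) / 2" unfolding \<eta>_def by (rule min.cobounded1)
    then have \<eta>: "\<eta> > 0" "\<eta> < 1 - a" "\<eta> \<le> d / (2 * (\<gamma> - 1))" using a \<open>d > 0\<close> False \<gamma> by (auto simp: \<eta>_def)
    have "\<eta> * (\<gamma> - 1) \<le> d / 2" using \<eta>(3) False \<gamma> by (simp add: field_simps)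
    then have "\<kappa> < expo (1 - a - \<eta>)" using False \<open>d > 0\<close> by (simp add: expo_def d_def cost_exponent_def algebra_simps)
    with \<eta> show ?thesis by (intro exI[of _ "1 - a - \<eta>"]) auto
  qed
  then obtain \<beta> where \<beta>: "\<beta> > 0" "\<beta> < 1 - a" "\<kappa> < expo \<beta>" by blast
  define c where "c = (if \<gamma> < 1 then 8 powr (\<gamma> - 1) else 1 :: real) / 24"
  have c: "c > 0" by (simp add: c_def)
  have "\<beta> * \<gamma> > 0" "a + \<beta> < 1" using \<beta> \<gamma> by auto
  have "\<forall>\<^sub>F N :: nat in sequentially. 48 * real N powr (a + \<beta>) \<le> real N"
    using \<open>a + \<beta> < 1\<close> by real_asymp
  moreover have "\<forall>\<^sub>F N :: nat in sequentially. real N powr \<kappa> \<le> c / 2 * real N powr expo \<beta>"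
    using \<beta>(3) c by real_asymp
  moreover have "\<forall>\<^sub>F N :: nat in sequentially. real N ^ 2 * exp (- (real N powr (\<beta> * \<gamma>)) / 2) \<le> 1"
    using \<open>\<beta> * \<gamma> > 0\<close> by real_asymp
  ultimately show ?thesis using eventually_ge_at_top[of 2]
  proof eventually_elim
    case (elim N)
    let ?l = "real N powr \<beta>" and ?h = "real N powr a"
    let ?W = "8 * ?h * ?l"
    let ?M = "c * real N powr expo \<beta>"
    have N: "N > 0" "real N > 1" using elim by auto
    have W: "?W = 8 * real N powr (a + \<beta>)" by (simp add: powr_add)
    have "real N powr (a + \<beta>) \<ge> 1" using N a \<beta> by (intro ge_one_powr_ge_zero) auto
    then have W1: "?W \<ge> 1" "6 * ?W \<le> real N" using W elim by simp_all
    have M: "real N / 24 * (if \<gamma> < 1 then ?W powr (\<gamma> - 1) else ?l powr (\<gamma> - 1)) = ?M"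
    proof (cases "\<gamma> < 1")
      case True
      have "?W powr (\<gamma> - 1) = 8 powr (\<gamma> - 1) * real N powr ((a + \<beta>) * (\<gamma> - 1))"
        unfolding W by (simp add: powr_mult powr_powr)
      with True N show ?thesis by (simp add: c_def expo_def powr_add)
    next
      case False
      with N show ?thesis by (simp add: c_def expo_def powr_add powr_powr)
    qed
    have l: "?l > 1" using N \<beta> by (simp add: gr_one_powr)
    have "{E \<in> graphs N. Hp p N E \<le> ?h} \<subseteq> {E. long_weight \<gamma> ?l E \<ge> ?M}"
      using small_Hp_long_weight[OF p N(1) _ _ _ \<gamma>(1) _ refl W1] N l unfolding M by auto
    then have "measure_pmf.prob (percolation \<gamma> N) {E \<in> graphs N. Hp p N E \<le> ?h}
        \<le> measure_pmf.prob (percolation \<gamma> N) {E. long_weight \<gamma> ?l E \<ge> ?M}"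
      by (rule measure_pmf.finite_measure_mono) simp
    also have "\<dots> \<le> exp (real N ^ 2 * exp (- (?l powr \<gamma>) / 2) - ?M / 2)"
      by (rule long_weight_tail[OF l \<gamma>(1)])
    also have "\<dots> \<le> exp (1 - real N powr \<kappa>)"
      using elim by (simp add: powr_powr)
    finally show ?case .
  qed
qed

text \<open>
  The energy of a graph with \<open>Hp > N powr (\<alpha> + \<epsilon>)\<close> alone exceeds the total price \<open>N powr (b + \<alpha>)\<close>
  of the dyadic graph. The price is a positive power of \<open>N\<close> when \<open>\<alpha> < 1\<close>, by
  \<open>cost_exponent_pos\<close>; for \<open>\<alpha> = 1\<close> the event is empty.
\<close>

lemma gibbs_upper_tail:
  assumes p: "1 \<le> p" and \<gamma>: "\<gamma> > 0" and \<epsilon>: "\<epsilon> > 0"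
  shows "(\<lambda>N. measure_pmf.prob (gibbs \<gamma> b p N) {E \<in> graphs N. Hp p N E > real N powr (\<alpha> \<gamma> b + \<epsilon>)})
    \<longlonglongrightarrow> 0"
proof (cases "\<alpha> \<gamma> b < 1")
  case True
  define s where "s = b + \<alpha> \<gamma> b"
  have s: "s > 0" using cost_exponent_pos[of \<gamma> "\<alpha> \<gamma> b"] cost_exponent_\<alpha>_le[OF \<gamma> True] \<gamma> True by (simp add: s_def)
  have "\<forall>\<^sub>F N in sequentially. partition_fun \<gamma> b p N \<ge> exp (- (real N powr (s + \<epsilon> / 2)))"
    unfolding s_def by (rule partition_fun_eventually_ge) (use p \<gamma> \<epsilon> in auto)
  then have "\<forall>\<^sub>F N in sequentially.
      measure_pmf.prob (gibbs \<gamma> b p N) {E \<in> graphs N. Hp p N E > real N powr (\<alpha> \<gamma> b + \<epsilon>)}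
      \<le> exp (real N powr (s + \<epsilon> / 2) - real N powr (s + \<epsilon>))"
  proof eventually_elim
    case (elim N)
    let ?A = "{E \<in> graphs N. Hp p N E > real N powr (\<alpha> \<gamma> b + \<epsilon>)}"
    have "measure_pmf.prob (gibbs \<gamma> b p N) ?A
        \<le> exp (- (real N powr b * real N powr (\<alpha> \<gamma> b + \<epsilon>))) * measure_pmf.prob (percolation \<gamma> N) ?A
          / partition_fun \<gamma> b p N"
      by (rule gibbs_prob_le) auto
    also have "\<dots> \<le> exp (- (real N powr b * real N powr (\<alpha> \<gamma> b + \<epsilon>))) * 1
        / exp (- (real N powr (s + \<epsilon> / 2)))"
      using elim by (intro frac_le mult_left_mono) (auto simp: measure_pmf.prob_le_1)
    also have "\<dots> = exp (real N powr (s + \<epsilon> / 2) - real N powr (s + \<epsilon>))"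
      by (simp add: powr_add[symmetric] s_def add_ac exp_diff exp_minus field_simps)
    finally show ?case .
  qed
  moreover have "(\<lambda>N :: nat. exp (real N powr (s + \<epsilon> / 2) - real N powr (s + \<epsilon>))) \<longlonglongrightarrow> 0"
    using s \<epsilon> by real_asymp
  ultimately show ?thesis
    by (rule tendsto_sandwich[OF _ _ tendsto_const, rotated]) simp
next
  case False
  then have 1: "\<alpha> \<gamma> b = 1" using \<alpha>_range[of \<gamma> b] by simp
  have "\<forall>\<^sub>F N in sequentially.
      measure_pmf.prob (gibbs \<gamma> b p N) {E \<in> graphs N. Hp p N E > real N powr (\<alpha> \<gamma> b + \<epsilon>)} = 0"
    using eventually_ge_at_top[of 1]
  proof eventually_elim
    case (elim N)
    have "Hp p N E \<le> real N powr (\<alpha> \<gamma> b + \<epsilon>)" if "E \<in> graphs N" for E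
    proof -
      have "Hp p N E \<le> real N"
        using elim p graph_dist_less[OF that] by (intro Hp_le) (auto intro: less_imp_le)
      also have "\<dots> \<le> real N powr (\<alpha> \<gamma> b + \<epsilon>)"
        using powr_mono[of 1 "\<alpha> \<gamma> b + \<epsilon>" "real N"] elim \<epsilon> 1 by simp
      finally show ?thesis .
    qed
    then have "{E \<in> graphs N. Hp p N E > real N powr (\<alpha> \<gamma> b + \<epsilon>)} = {}" by force
    then show ?case by (simp only: measure_empty)
  qed
  then show ?thesis by (rule tendsto_eventually)
qed

text \<open>
  The cost of bringing \<open>Hp\<close> down to \<open>N powr a\<close> with \<open>a < \<alpha>\<close> exceeds \<open>N powr (b + \<alpha>)\<close>, because
  \<open>cost_exponent\<close> is strictly decreasing; the energy is simply bounded below by 0. For \<open>\<alpha> = 0\<close>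
  the event is empty for large \<open>N\<close>.
\<close>

lemma gibbs_lower_tail:
  assumes p: "1 \<le> p" and \<gamma>: "\<gamma> > 0" "\<gamma> \<noteq> 1" and \<epsilon>: "\<epsilon> > 0"
  shows "(\<lambda>N. measure_pmf.prob (gibbs \<gamma> b p N) {E \<in> graphs N. Hp p N E < real N powr (\<alpha> \<gamma> b - \<epsilon>)})
    \<longlonglongrightarrow> 0"
proof (cases "\<alpha> \<gamma> b > 0")
  case True
  \<comment> \<open>The maximum with \<open>\<alpha> \<gamma> b / 2\<close> keeps \<open>a\<close> positive when \<open>\<epsilon>\<close> is large.\<close>
  define a where "a = max (\<alpha> \<gamma> b - \<epsilon>) (\<alpha> \<gamma> b / 2)"
  have a: "\<alpha> \<gamma> b - \<epsilon> \<le> a" "0 < a" "a < \<alpha> \<gamma> b" using True \<epsilon> by (auto simp: a_def)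
  define m where "m = max (b + \<alpha> \<gamma> b) 0"
  define r where "r = cost_exponent \<gamma> a"
  have "m < r"
    using cost_exponent_\<alpha>_ge[OF \<gamma>(1) True] cost_exponent_strict_antimono[OF \<gamma>(2) a(3)] cost_exponent_pos[OF \<gamma>(1), of a] a \<alpha>_range[of \<gamma> b]
    by (auto simp: m_def r_def)
  \<comment> \<open>Two exponents strictly between \<open>m\<close> and \<open>r\<close>: \<open>s\<close> for the partition function, \<open>\<kappa>\<close> for the percolation tail.\<close>
  define s where "s = (2 * m + r) / 3"
  define \<kappa> where "\<kappa> = (m + 2 * r) / 3"
  have s: "b + \<alpha> \<gamma> b < s" "s < \<kappa>" "\<kappa> < r" "0 < \<kappa>" "0 < s"
  proof -
    have "m \<ge> 0" "b + \<alpha> \<gamma> b \<le> m" by (auto simp: m_def)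
    then show "b + \<alpha> \<gamma> b < s" "s < \<kappa>" "\<kappa> < r" "0 < \<kappa>" "0 < s"
      using \<open>m < r\<close> by (simp_all add: s_def \<kappa>_def)
  qed
  have "\<forall>\<^sub>F N in sequentially. partition_fun \<gamma> b p N \<ge> exp (- (real N powr (b + \<alpha> \<gamma> b + (s - (b + \<alpha> \<gamma> b)))))"
    by (rule partition_fun_eventually_ge) (use p \<gamma> s in auto)
  moreover have "\<forall>\<^sub>F N in sequentially.
      measure_pmf.prob (percolation \<gamma> N) {E \<in> graphs N. Hp p N E \<le> real N powr a} \<le> exp (1 - real N powr \<kappa>)"
    by (rule percolation_small_Hp) (use p \<gamma> s a \<alpha>_range[of \<gamma> b] in \<open>auto simp: r_def\<close>)
  ultimately have "\<forall>\<^sub>F N in sequentially.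
      measure_pmf.prob (gibbs \<gamma> b p N) {E \<in> graphs N. Hp p N E < real N powr (\<alpha> \<gamma> b - \<epsilon>)}
      \<le> exp (1 + real N powr s - real N powr \<kappa>)"
    using eventually_ge_at_top[of 2]
  proof eventually_elim
    case (elim N)
    let ?A = "{E \<in> graphs N. Hp p N E \<le> real N powr a}"
    have "real N powr (\<alpha> \<gamma> b - \<epsilon>) \<le> real N powr a" using a elim by (intro powr_mono) auto
    then have "measure_pmf.prob (gibbs \<gamma> b p N) {E \<in> graphs N. Hp p N E < real N powr (\<alpha> \<gamma> b - \<epsilon>)}
        \<le> measure_pmf.prob (gibbs \<gamma> b p N) ?A"
      by (intro measure_pmf.finite_measure_mono) auto
    also have "\<dots> \<le> exp (- (real N powr b * 0)) * measure_pmf.prob (percolation \<gamma> N) ?A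
          / partition_fun \<gamma> b p N"
    proof (rule gibbs_prob_le)
      fix E assume "E \<in> ?A"
      then show "0 \<le> Hp p N E" using Hp_lower_trivial[OF p elim(3), of E] by simp
    qed auto
    also have "\<dots> \<le> exp (1 - real N powr \<kappa>) / exp (- (real N powr s))"
      using elim by (intro frac_le) auto
    also have "\<dots> = exp (1 + real N powr s - real N powr \<kappa>)"
      by (simp add: exp_diff[symmetric] algebra_simps)
    finally show ?case .
  qed
  moreover have "(\<lambda>N :: nat. exp (1 + real N powr s - real N powr \<kappa>)) \<longlonglongrightarrow> 0"
    using s(2,4,5) by real_asymp
  ultimately show ?thesis
    by (rule tendsto_sandwich[OF _ _ tendsto_const, rotated]) simp
next
  case False
  then have 0: "\<alpha> \<gamma> b = 0" using \<alpha>_range[of \<gamma> b] by simp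
  have "\<forall>\<^sub>F N :: nat in sequentially. real N powr (- \<epsilon>) \<le> 1 / 5"
    using \<epsilon> by real_asymp
  then have "\<forall>\<^sub>F N in sequentially.
      measure_pmf.prob (gibbs \<gamma> b p N) {E \<in> graphs N. Hp p N E < real N powr (\<alpha> \<gamma> b - \<epsilon>)} = 0"
    using eventually_ge_at_top[of 2]
  proof eventually_elim
    case (elim N)
    then have "{E \<in> graphs N. Hp p N E < real N powr (\<alpha> \<gamma> b - \<epsilon>)} = {}"
      using Hp_lower_trivial[OF p elim(2)] 0 by fastforce
    then show ?case by (simp only: measure_empty)
  qed
  then show ?thesis by (rule tendsto_eventually)
qed

theorem theorem1p1:
  fixes \<gamma> b \<epsilon> :: real and p :: ereal
  assumes "\<gamma> > 0" and "\<gamma> \<noteq> 1" and "1 \<le> p" and "\<epsilon> > 0"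
  shows "(\<lambda>N. measure_pmf.prob (gibbs \<gamma> b p N)
            {E \<in> graphs N. \<bar>ln (Hp p N E) / ln (real N) - \<alpha> \<gamma> b\<bar> > \<epsilon>}) \<longlonglongrightarrow> 0"
proof (rule tendsto_sandwich[OF _ _ tendsto_const])
  let ?U = "\<lambda>N. {E \<in> graphs N. Hp p N E > real N powr (\<alpha> \<gamma> b + \<epsilon>)}"
  let ?L = "\<lambda>N. {E \<in> graphs N. Hp p N E < real N powr (\<alpha> \<gamma> b - \<epsilon>)}"
  let ?P = "\<lambda>N. measure_pmf.prob (gibbs \<gamma> b p N)"
  show "(\<lambda>N. ?P N (?U N) + ?P N (?L N)) \<longlonglongrightarrow> 0"
    using tendsto_add[OF gibbs_upper_tail gibbs_lower_tail] assms by simp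
  show "\<forall>\<^sub>F N in sequentially. ?P N {E \<in> graphs N. \<bar>ln (Hp p N E) / ln (real N) - \<alpha> \<gamma> b\<bar> > \<epsilon>}
      \<le> ?P N (?U N) + ?P N (?L N)"
    using eventually_ge_at_top[of 2]
  proof eventually_elim
    case (elim N)
    have "{E \<in> graphs N. \<bar>ln (Hp p N E) / ln (real N) - \<alpha> \<gamma> b\<bar> > \<epsilon>} \<subseteq> ?U N \<union> ?L N"
    proof
      fix E
      assume E: "E \<in> {E \<in> graphs N. \<bar>ln (Hp p N E) / ln (real N) - \<alpha> \<gamma> b\<bar> > \<epsilon>}"
      then have pos: "Hp p N E > 0" using Hp_lower_trivial[OF assms(3) elim, of E] by simp
      have lnN: "ln (real N) > 0" using elim by simp
      have eq: "Hp p N E = real N powr (ln (Hp p N E) / ln (real N))"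
        using elim pos lnN by (simp add: powr_def)
      consider "ln (Hp p N E) / ln (real N) > \<alpha> \<gamma> b + \<epsilon>" | "ln (Hp p N E) / ln (real N) < \<alpha> \<gamma> b - \<epsilon>"
        using E by force
      then show "E \<in> ?U N \<union> ?L N"
      proof cases
        case 1
        then have "real N powr (\<alpha> \<gamma> b + \<epsilon>) < Hp p N E"
          using elim by (subst eq) (intro powr_less_mono, auto)
        with E show ?thesis by simp
      next
        case 2
        then have "Hp p N E < real N powr (\<alpha> \<gamma> b - \<epsilon>)"
          using elim by (subst eq) (intro powr_less_mono, auto)
        with E show ?thesis by simp
      qed
    qed
    then have "?P N {E \<in> graphs N. \<bar>ln (Hp p N E) / ln (real N) - \<alpha> \<gamma> b\<bar> > \<epsilon>} \<le> ?P N (?U N \<union> ?L N)"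
      by (intro measure_pmf.finite_measure_mono) auto
    also have "\<dots> \<le> ?P N (?U N) + ?P N (?L N)"
      by (intro measure_Un_le) auto
    finally show ?case .
  qed
qed simp

end
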